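(* Let $\mu_1,\dots,\mu_m$ be per-coordinate laws on the grid $\eta\mathbb{Z}$, where $\mu_i$ is the (possibly tilted) law of the grid surprisal of coordinate $i$, with $b_i$ atoms. (i) The support-aware balanced merge of the $m$ per-coordinate laws, plus a cumulative sum, costs $\widetilde O(R/\eta+B_{\mathrm{in}})$ time and $\Theta(R/\eta+m)$ space. (ii) Suppose the chain is $\tfrac12$-decaying. Then each partial convolution over a block $I\subseteq\{1,\dots,m\}$ of coordinates carries all but a $\mathrm{poly}^{-1}$ fraction of its mass on $\widetilde O(\sqrt{B_I}/\eta)$ grid points around its analytically known mean, where $B_I=\sum_{i\in I}b_i$. Truncating every merge node to this window perturbs the output by $\mathrm{poly}^{-1}$ in $\ell_1$, and the cost drops to $\widetilde O\big((\sqrt{mB_{\mathrm{in}}}+m)/\eta\big)$ time (which is $\widetilde O(m/\eta)$ for bounded alphabets) and $\widetilde O(\sqrt{B_{\mathrm{in}}}/\eta)$ space, independently of $R$.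
   Context: Setting: $A_1,\dots,A_m$ finite sets, $b_i=|A_i|$, $B_{\mathrm{in}}=\sum_ib_i$; $p_i$ a probability distribution on $A_i$ with $p_i(a)>0$; per-coordinate surprisals $s_i(a)=-\ln p_i(a)$; grid surprisals $\widetilde s_i(a)\in\eta\mathbb{Z}$, obtained by rounding strictly up, $\widetilde s_i(a)=\eta(\lfloor s_i(a)/\eta\rfloor+1)$ (or $\widetilde s_i=s_i$ when all $s_i(a)$ already lie in $\eta\mathbb{Z}$). $R=\sum_i(\max_as_i(a)-\min_as_i(a))$ is the surprisal range. A "chain" is one family of per-coordinate histograms carried through the computation: the count chain has atom weights $1/b_i$ at $\widetilde s_i(a)$; the mass chain has atom weights $p_i(a)$ at $\widetilde s_i(a)$. The tilt of a grid law $\mu$ by $\phi$ is $\mu^{(\phi)}(w)=e^{\phi w-\Lambda_\mu(\phi)}\mu(w)$ with $\Lambda_\mu(\phi)=\ln\sum_we^{\phi w}\mu(w)$. A (tilted) chain is $\tfrac12$-decaying if within every coordinate the tilted atom weights $\omega_a$ fall off exponentially in the surprisal, at a rate of at least $\tfrac12$ per unit above the per-coordinate minimum: $\omega_a\le e^{\eta}e^{-\gamma u_a}\omega_{a_{\min}}$ with $\gamma\ge\tfrac12$, $u_a=\widetilde s_i(a)-\min_{a'}\widetilde s_i(a')$, and $a_{\min}$ the minimal-surprisal symbol. Support-aware balanced merge: the $m$ laws are convolved along a balanced binary tree of depth $\lceil\log_2m\rceil$, each convolution done by an FFT sized to the actual support of its output; a node of the tree corresponds to a block $I$ of coordinates and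 holds the convolution of $\mu_i$, $i\in I$, whose mean is the sum of the means of the $\mu_i$. The truncated version sets to zero, at each node, all entries outside the stated window around the mean. The output is the law at the root. $\mathrm{poly}$ denotes a fixed polynomial in $m$ and $1/\eta$; $\widetilde O$ suppresses polylogarithmic factors; costs are in word operations at fixed precision.
   Formalization: In (ii), η is bounded by an arbitrary fixed η₀ on which constants may depend (the window bound fails as η→∞), and the laws are read-only input: time counts the merge and cumulative sum, space counts working memory, since reading B_in atoms or holding m arrays would break the bounds. *)

theory Defs
  imports
    "HOL-Probability.Probability"
    "HOL-Probability.Product_PMF"
    "HOL-Computational_Algebra.Polynomial"
begin

section \<open>Surprisals and chains\<close>

text \<open>
  Coordinates are \<open>0, \<dots>, m - 1\<close>. The distribution on \<open>A\<^sub>i\<close> is a pmf \<open>p i\<close> and \<open>A\<^sub>i\<close> is its support,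
  so that all probabilities on \<open>A\<^sub>i\<close> are positive.
\<close>

abbreviation alphabet :: "(nat \<Rightarrow> 'a pmf) \<Rightarrow> nat \<Rightarrow> 'a set" where
  "alphabet p i \<equiv> set_pmf (p i)"

definition block_size :: "(nat \<Rightarrow> 'a pmf) \<Rightarrow> nat set \<Rightarrow> nat" where
  "block_size p I = (\<Sum>i\<in>I. card (alphabet p i))"

definition surprisal :: "(nat \<Rightarrow> 'a pmf) \<Rightarrow> nat \<Rightarrow> 'a \<Rightarrow> real" where
  "surprisal p i a = - ln (pmf (p i) a)"

definition surprisal_range :: "(nat \<Rightarrow> 'a pmf) \<Rightarrow> nat \<Rightarrow> real" where
  "surprisal_range p m =
     (\<Sum>i<m. Max (surprisal p i ` alphabet p i) - Min (surprisal p i ` alphabet p i))"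

text \<open>Either every surprisal is rounded strictly up, or all of them are on the grid and are kept.\<close>

definition grid_surprisals ::
  "nat \<Rightarrow> real \<Rightarrow> (nat \<Rightarrow> 'a pmf) \<Rightarrow> (nat \<Rightarrow> 'a \<Rightarrow> real) \<Rightarrow> bool" where
  "grid_surprisals m \<eta> p st \<longleftrightarrow>
     (\<forall>i<m. \<forall>a\<in>alphabet p i. st i a = \<eta> * of_int (\<lfloor>surprisal p i a / \<eta>\<rfloor> + 1)) \<or>
     (\<forall>i<m. \<forall>a\<in>alphabet p i. (\<exists>j::int. surprisal p i a = \<eta> * of_int j) \<and> st i a = surprisal p i a)"

definition setting ::
  "nat \<Rightarrow> real \<Rightarrow> (nat \<Rightarrow> 'a pmf) \<Rightarrow> (nat \<Rightarrow> 'a \<Rightarrow> real) \<Rightarrow> bool" where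
  "setting m \<eta> p st \<longleftrightarrow>
     m \<ge> 1 \<and> \<eta> > 0 \<and> (\<forall>i<m. finite (alphabet p i)) \<and> grid_surprisals m \<eta> p st"

datatype chain = Count | Mass

fun atom_pmf :: "chain \<Rightarrow> 'a pmf \<Rightarrow> 'a pmf" where
  "atom_pmf Count q = pmf_of_set (set_pmf q)"
| "atom_pmf Mass q = q"

definition log_mgf :: "real pmf \<Rightarrow> real \<Rightarrow> real" where
  "log_mgf \<mu> \<phi> = ln (\<Sum>w\<in>set_pmf \<mu>. exp (\<phi> * w) * pmf \<mu> w)"

definition tilt :: "real \<Rightarrow> real pmf \<Rightarrow> real pmf" where
  "tilt \<phi> \<mu> = embed_pmf (\<lambda>w. exp (\<phi> * w - log_mgf \<mu> \<phi>) * pmf \<mu> w)"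

text \<open>The untilted chain is the case \<open>\<phi> = 0\<close>.\<close>

definition chain_law ::
  "chain \<Rightarrow> real \<Rightarrow> (nat \<Rightarrow> 'a pmf) \<Rightarrow> (nat \<Rightarrow> 'a \<Rightarrow> real) \<Rightarrow> nat \<Rightarrow> real pmf" where
  "chain_law ch \<phi> p st i = tilt \<phi> (map_pmf (st i) (atom_pmf ch (p i)))"

definition atom_weight ::
  "chain \<Rightarrow> real \<Rightarrow> (nat \<Rightarrow> 'a pmf) \<Rightarrow> (nat \<Rightarrow> 'a \<Rightarrow> real) \<Rightarrow> nat \<Rightarrow> 'a \<Rightarrow> real" where
  "atom_weight ch \<phi> p st i a =
     exp (\<phi> * st i a - log_mgf (map_pmf (st i) (atom_pmf ch (p i))) \<phi>) * pmf (atom_pmf ch (p i)) a"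

text \<open>
  The minimal-surprisal symbol is taken with respect to the unrounded surprisal: symbols that tie
  there have equal probability, hence equal atom weight, so the choice of \<open>a\<^sub>0\<close> is immaterial.
\<close>

definition half_decaying ::
  "nat \<Rightarrow> real \<Rightarrow> chain \<Rightarrow> real \<Rightarrow> (nat \<Rightarrow> 'a pmf) \<Rightarrow> (nat \<Rightarrow> 'a \<Rightarrow> real) \<Rightarrow> bool" where
  "half_decaying m \<eta> ch \<phi> p st \<longleftrightarrow>
     (\<exists>\<gamma>\<ge>1/2. \<forall>i<m. \<forall>a\<in>alphabet p i. \<forall>a\<^sub>0\<in>alphabet p i.
        (\<forall>a'\<in>alphabet p i. surprisal p i a\<^sub>0 \<le> surprisal p i a') \<longrightarrow>
        atom_weight ch \<phi> p st i a
          \<le> exp \<eta> * exp (- \<gamma> * (st i a - Min (st i ` alphabet p i))) * atom_weight ch \<phi> p st i a\<^sub>0)"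

definition block_law :: "(nat \<Rightarrow> real pmf) \<Rightarrow> nat set \<Rightarrow> real pmf" where
  "block_law \<mu> I = map_pmf (\<lambda>x. \<Sum>i\<in>I. x i) (Pi_pmf I 0 \<mu>)"

definition block_mean :: "(nat \<Rightarrow> real pmf) \<Rightarrow> nat set \<Rightarrow> real" where
  "block_mean \<mu> I = (\<Sum>i\<in>I. measure_pmf.expectation (\<mu> i) (\<lambda>w. w))"


section \<open>Convolution by FFT\<close>

text \<open>
  Lists model arrays with unit-cost access, and an arithmetic operation on fixed-precision (real or
  complex) numbers is a unit-cost word operation; \<open>T_f\<close> and \<open>S_f\<close> count the word operations and
  the words of memory used by \<open>f\<close>. Rounding errors of the arithmetic are not modelled.
\<close>

text \<open>Radix 2 transform of length \<open>2 ^ k\<close>, for a primitive \<open>2 ^ k\<close>-th root of unity \<open>w\<close>.\<close>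

fun fft :: "nat \<Rightarrow> complex \<Rightarrow> complex list \<Rightarrow> complex list" where
  "fft 0 w xs = xs"
| "fft (Suc k) w xs =
     (let es = fft k (w * w) (map (\<lambda>j. xs ! (2 * j)) [0..<2 ^ k]);
          os = fft k (w * w) (map (\<lambda>j. xs ! (2 * j + 1)) [0..<2 ^ k])
      in map (\<lambda>j. es ! j + w ^ j * os ! j) [0..<2 ^ k] @
         map (\<lambda>j. es ! j - w ^ j * os ! j) [0..<2 ^ k])"

text \<open>
  Per index \<open>j\<close>: two moves for the split, the update of the running power \<open>w ^ j\<close>, and one
  multiplication, addition and subtraction. The memory is that for the two halves and their
  transforms, on top of the input and the output array.
\<close>

fun T_fft :: "nat \<Rightarrow> nat" where
  "T_fft 0 = 1"
| "T_fft (Suc k) = 2 * T_fft k + 6 * 2 ^ k"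

fun S_fft :: "nat \<Rightarrow> nat" where
  "S_fft 0 = 0"
| "S_fft (Suc k) = S_fft k + 4 * 2 ^ k"

definition fft_exponent :: "nat \<Rightarrow> nat" where
  "fft_exponent n = (LEAST k. n \<le> 2 ^ k)"

definition fft_conv :: "real list \<Rightarrow> real list \<Rightarrow> real list" where
  "fft_conv xs ys =
     (if xs = [] \<or> ys = [] then [] else
      let n = length xs + length ys - 1;
          k = fft_exponent n;
          w = cis (2 * pi / 2 ^ k);
          pad = (\<lambda>zs. map complex_of_real zs @ replicate (2 ^ k - length zs) 0);
          prod = map2 (*) (fft k w (pad xs)) (fft k w (pad ys))
      in map (\<lambda>z. Re z / 2 ^ k) (take n (fft k (cnj w) prod)))"

text \<open>Three transforms; padding (twice), pointwise product and scaling.\<close>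

definition T_conv :: "nat \<Rightarrow> nat \<Rightarrow> nat" where
  "T_conv n1 n2 =
     (if n1 = 0 \<or> n2 = 0 then 1 else
      let k = fft_exponent (n1 + n2 - 1) in 3 * T_fft k + 4 * 2 ^ k + 1)"

text \<open>Six complex arrays (padded inputs, their transforms, product, inverse transform), the memory
  of a transform, and the real output array; a complex number takes two words.\<close>

definition S_conv :: "nat \<Rightarrow> nat \<Rightarrow> nat" where
  "S_conv n1 n2 =
     (if n1 = 0 \<or> n2 = 0 then 1 else
      let k = fft_exponent (n1 + n2 - 1) in 12 * 2 ^ k + 2 * S_fft k + (n1 + n2 - 1))"


section \<open>Balanced merge\<close>

text \<open>\<open>(lo, xs)\<close> stores the values at the grid points \<open>lo * \<eta>, (lo + 1) * \<eta>, \<dots>\<close>; it is zero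
  elsewhere.\<close>

type_synonym grid_array = "int \<times> real list"

fun entry :: "grid_array \<Rightarrow> int \<Rightarrow> real" where
  "entry (lo, xs) j = (if lo \<le> j \<and> nat (j - lo) < length xs then xs ! nat (j - lo) else 0)"

abbreviation len :: "grid_array \<Rightarrow> nat" where
  "len A \<equiv> length (snd A)"

text \<open>Entries and offset.\<close>

abbreviation words :: "grid_array \<Rightarrow> nat" where
  "words A \<equiv> len A + 1"

definition l1_dist :: "grid_array \<Rightarrow> grid_array \<Rightarrow> real" where
  "l1_dist A B = (\<Sum>j | entry A j \<noteq> 0 \<or> entry B j \<noteq> 0. \<bar>entry A j - entry B j\<bar>)"

definition histogram :: "real \<Rightarrow> real pmf \<Rightarrow> grid_array" where
  "histogram \<eta> \<mu> =
     (let J = {j::int. of_int j * \<eta> \<in> set_pmf \<mu>}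
      in (Min J, map (\<lambda>j. pmf \<mu> (of_int j * \<eta>)) [Min J..Max J]))"

fun conv :: "grid_array \<Rightarrow> grid_array \<Rightarrow> grid_array" where
  "conv (lo1, xs) (lo2, ys) = (lo1 + lo2, fft_conv xs ys)"

text \<open>Only the grid points at distance at most \<open>h\<close> from \<open>c\<close> are kept.\<close>

fun window :: "real \<Rightarrow> real \<Rightarrow> real \<Rightarrow> grid_array \<Rightarrow> grid_array" where
  "window \<eta> c h (lo, xs) =
     (let l = max lo \<lceil>(c - h) / \<eta>\<rceil>;
          r = min (lo + int (length xs) - 1) \<lfloor>(c + h) / \<eta>\<rfloor>
      in (l, map (\<lambda>j. xs ! nat (j - lo)) [l..r]))"

datatype mtree = Coord nat | Join mtree mtree

fun coords :: "mtree \<Rightarrow> nat list" where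
  "coords (Coord i) = [i]"
| "coords (Join l r) = coords l @ coords r"

fun depth :: "mtree \<Rightarrow> nat" where
  "depth (Coord i) = 0"
| "depth (Join l r) = Suc (max (depth l) (depth r))"

definition balanced_tree :: "nat \<Rightarrow> mtree \<Rightarrow> bool" where
  "balanced_tree m t \<longleftrightarrow>
     distinct (coords t) \<and> set (coords t) = {..<m} \<and> int (depth t) = \<lceil>log 2 (real m)\<rceil>"

text \<open>\<open>H i\<close> is the array of coordinate \<open>i\<close>; \<open>crop I\<close> is applied to the array of the node with block
  \<open>I\<close>, at leaves as well as at inner nodes.\<close>

fun merge :: "(nat \<Rightarrow> grid_array) \<Rightarrow> (nat set \<Rightarrow> grid_array \<Rightarrow> grid_array) \<Rightarrow> mtree \<Rightarrow> grid_array" where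
  "merge H crop (Coord i) = crop {i} (H i)"
| "merge H crop (Join l r) =
     crop (set (coords (Join l r))) (conv (merge H crop l) (merge H crop r))"

fun T_merge :: "(nat \<Rightarrow> grid_array) \<Rightarrow> (nat set \<Rightarrow> grid_array \<Rightarrow> grid_array) \<Rightarrow> mtree \<Rightarrow> nat" where
  "T_merge H crop (Coord i) = len (merge H crop (Coord i)) + 1"
| "T_merge H crop (Join l r) =
     T_merge H crop l + T_merge H crop r
     + T_conv (len (merge H crop l)) (len (merge H crop r)) + len (merge H crop (Join l r)) + 1"

text \<open>
  Peak memory of the depth-first evaluation of the tree, left subtree first. \<open>pend i\<close> is the number
  of words that coordinate \<open>i\<close> occupies before its leaf is visited: the size of its array if all
  per-coordinate arrays are resident from the start, and \<open>0\<close> if a leaf is only brought into memory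
  when it is visited.
\<close>

fun S_merge ::
  "(nat \<Rightarrow> nat) \<Rightarrow> (nat \<Rightarrow> grid_array) \<Rightarrow> (nat set \<Rightarrow> grid_array \<Rightarrow> grid_array) \<Rightarrow> mtree \<Rightarrow> nat" where
  "S_merge pend H crop (Coord i) = words (merge H crop (Coord i))"
| "S_merge pend H crop (Join l r) =
     (let A = merge H crop l; B = merge H crop r
      in max (S_merge pend H crop l + (\<Sum>i\<leftarrow>coords r. pend i))
           (max (words A + S_merge pend H crop r)
                (words A + words B + S_conv (len A) (len B))))"

abbreviation no_crop :: "nat set \<Rightarrow> grid_array \<Rightarrow> grid_array" where
  "no_crop \<equiv> (\<lambda>I A. A)"

text \<open>
  The full computation builds the per-coordinate arrays from the \<open>b i\<close> atoms (initialisation, then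
  one update per atom), merges them and forms the cumulative sum; the arrays are resident.
\<close>

definition full_time :: "(nat \<Rightarrow> nat) \<Rightarrow> (nat \<Rightarrow> grid_array) \<Rightarrow> mtree \<Rightarrow> nat" where
  "full_time b H t =
     (\<Sum>i\<leftarrow>coords t. b i + len (H i)) + T_merge H no_crop t + len (merge H no_crop t)"

definition full_space :: "(nat \<Rightarrow> grid_array) \<Rightarrow> mtree \<Rightarrow> nat" where
  "full_space H t =
     max (S_merge (\<lambda>i. words (H i)) H no_crop t) (2 * words (merge H no_crop t))"

text \<open>
  The truncated computation takes the laws as read-only input, from which the windows of the leaves
  are copied when they are visited; only its own working memory counts.
\<close>

definition truncated_time ::
  "(nat \<Rightarrow> grid_array) \<Rightarrow> (nat set \<Rightarrow> grid_array \<Rightarrow> grid_array) \<Rightarrow> mtree \<Rightarrow> nat" where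
  "truncated_time H crop t = T_merge H crop t + len (merge H crop t)"

definition truncated_space ::
  "(nat \<Rightarrow> grid_array) \<Rightarrow> (nat set \<Rightarrow> grid_array \<Rightarrow> grid_array) \<Rightarrow> mtree \<Rightarrow> nat" where
  "truncated_space H crop t = max (S_merge (\<lambda>i. 0) H crop t) (2 * words (merge H crop t))"


section \<open>Windows and asymptotic bounds\<close>

definition polylog :: "nat \<Rightarrow> real \<Rightarrow> real" where
  "polylog k x = ln (2 + x) ^ k"

definition half_width :: "real \<Rightarrow> nat \<Rightarrow> nat \<Rightarrow> real \<Rightarrow> (nat \<Rightarrow> 'a pmf) \<Rightarrow> nat set \<Rightarrow> real" where
  "half_width C k m \<eta> p I = C * sqrt (block_size p I) * polylog k (m + 1 / \<eta>)"

text \<open>A polynomial in two variables, as a polynomial in the first one over polynomials in the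
  second one.\<close>

definition poly2 :: "real poly poly \<Rightarrow> real \<Rightarrow> real \<Rightarrow> real" where
  "poly2 P x y = poly (poly P [:x:]) y"

end

theory Submission
  imports Defs
begin

text \<open>
  An array that stores a law exactly has as many entries as its coordinates contribute to the
  surprisal range, so every level of the balanced tree costs FFTs of total length \<open>O(R/\<eta> + m)\<close>.

  In a decaying chain the surprisal above its minimum has an exponential tail of rate \<open>1/2\<close> with at
  most \<open>b\<^sub>i\<close> atoms, hence \<open>E exp (\<lambda> (w - E w)) \<le> exp (O(b\<^sub>i \<lambda>\<^sup>2))\<close> for \<open>\<bar>\<lambda>\<bar> \<le> 1/4\<close>. Multiplying over a
  block and taking \<open>\<lambda> = 1 / (4 sqrt B\<^sub>I)\<close>, the tail beyond \<open>c sqrt B\<^sub>I ln (2 + m + 1/\<eta>)\<close> is an arbitrarily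
  large negative power of \<open>2 + m + 1/\<eta>\<close>. Truncated arrays stay pointwise below the exact ones, so the
  \<open>\<ell>\<^sub>1\<close> error is the missing mass, which adds up over the \<open>2 m - 1\<close> nodes. The cost per level is
  governed by \<open>\<Sum> sqrt B\<^sub>I \<le> sqrt (m B)\<close> (Cauchy-Schwarz).
\<close>

section \<open>FFT convolution\<close>

lemma sum_lessThan_double:
  fixes f :: "nat \<Rightarrow> 'b::comm_monoid_add"
  shows "(\<Sum>i<2 * n. f i) = (\<Sum>i<n. f (2 * i)) + (\<Sum>i<n. f (2 * i + 1))"
  by (induction n) (simp_all add: algebra_simps)

lemma fft_eq_dft:
  assumes "length xs = 2 ^ k" "k > 0 \<Longrightarrow> w ^ 2 ^ (k - 1) = -1"
  shows "fft k w xs = map (\<lambda>j. \<Sum>i<2 ^ k. xs ! i * w ^ (i * j)) [0..<2 ^ k]"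
  using assms
proof (induction k arbitrary: w xs)
  case 0
  then show ?case by (cases xs) simp_all
next
  case (Suc k)
  let ?N = "2 ^ k :: nat"
  define D where "D j = (\<Sum>i<2 ^ Suc k. xs ! i * w ^ (i * j))" for j
  define E where "E = (\<lambda>j. \<Sum>i<?N. xs ! (2 * i) * (w * w) ^ (i * j))"
  define F where "F = (\<lambda>j. \<Sum>i<?N. xs ! (2 * i + 1) * (w * w) ^ (i * j))"
  have half: "w ^ ?N = -1" using Suc.prems by simp
  have prim: "(w * w) ^ 2 ^ (k - 1) = -1" if "k > 0"
    using half that by (cases k) (simp_all add: power_mult power2_eq_square)
  have es: "fft k (w * w) (map (\<lambda>j. xs ! (2 * j)) [0..<?N]) = map E [0..<?N]"
    unfolding E_def by (subst Suc.IH) (use prim in \<open>auto intro!: sum.cong\<close>)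
  have os: "fft k (w * w) (map (\<lambda>j. xs ! (2 * j + 1)) [0..<?N]) = map F [0..<?N]"
    unfolding F_def by (subst Suc.IH) (use prim in \<open>auto intro!: sum.cong\<close>)
  have sq_power: "(w * w) ^ n = w ^ (2 * n)" for n
    by (simp add: power_mult power2_eq_square)
  have D: "D j = E j + w ^ j * F j" for j
    unfolding D_def E_def F_def power_Suc[of 2] sq_power
    by (subst sum_lessThan_double) (simp add: sum_distrib_left power_add algebra_simps)
  have sq: "(w * w) ^ ?N = 1"
    using half by (simp add: power_mult_distrib)
  have per: "E (?N + j) = E j" "F (?N + j) = F j" for j
  proof -
    have "(w * w) ^ (i * (?N + j)) = (w * w) ^ (i * j)" for i
      by (simp add: distrib_left power_add mult.commute[of i ?N] power_mult[of _ ?N] sq)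
    then show "E (?N + j) = E j" "F (?N + j) = F j"
      by (simp_all add: E_def F_def)
  qed
  have D': "D (?N + j) = E j - w ^ j * F j" for j
    using half by (simp add: D per power_add)
  have "fft (Suc k) w xs = map D [0..<?N] @ map (\<lambda>j. D (?N + j)) [0..<?N]"
    by (simp only: fft.simps Let_def es os D') (simp add: D)
  also have "\<dots> = map D ([0..<?N] @ map (\<lambda>j. ?N + j) [0..<?N])"
    by simp
  also have "map (\<lambda>j. ?N + j) [0..<?N] = [?N..<?N + ?N]"
    by (auto intro: nth_equalityI)
  also have "[0..<?N] @ \<dots> = [0..<2 ^ Suc k]"
    using upt_add_eq_append[of 0 ?N ?N] by (simp add: mult_2)
  finally show ?case by (simp add: D_def)
qed

lemma cis_root_half: "k > 0 \<Longrightarrow> cis (2 * pi / 2 ^ k) ^ 2 ^ (k - 1) = -1"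
  by (cases k) (simp_all add: Complex.DeMoivre)

lemma cis_multiple_eq_1_iff:
  fixes d :: int and N :: nat
  assumes "N > 0" "\<bar>d\<bar> < int N"
  shows "cis (2 * pi * d / N) = 1 \<longleftrightarrow> d = 0"
proof
  assume "cis (2 * pi * d / N) = 1"
  then have "cos (2 * pi * d / N) = 1"
    by (simp add: complex_eq_iff)
  then obtain x :: int where "2 * pi * d / N = of_int x * 2 * pi"
    using cos_one_2pi_int by blast
  then have "real_of_int d = x * real N"
    using assms(1) by (simp add: field_simps)
  then have "d = x * int N"
    by (metis of_int_eq_iff of_int_mult of_int_of_nat_eq)
  then show "d = 0"
    using assms by (auto simp: abs_mult)
qed auto

lemma sum_powers_root_of_unity:
  fixes d :: int and N :: nat
  assumes "N > 0" "\<bar>d\<bar> < int N"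
  shows "(\<Sum>j<N. cis (2 * pi * d / N) ^ j) = (if d = 0 then of_nat N else 0)"
proof (cases "d = 0")
  case False
  have "cis (2 * pi * d / N) ^ N = cis (2 * pi * d)"
    using assms by (simp add: Complex.DeMoivre)
  also have "\<dots> = 1"
    using cis_multiple_2pi[of "of_int d"] by (simp add: mult.assoc)
  finally show ?thesis
    using False cis_multiple_eq_1_iff[OF assms] by (simp add: geometric_sum)
qed simp

lemma
  shows le_fft_exponent: "n \<le> 2 ^ fft_exponent n"
    and fft_exponent_le: "n > 0 \<Longrightarrow> 2 ^ fft_exponent n \<le> 2 * n"
proof -
  show "n \<le> 2 ^ fft_exponent n"
    unfolding fft_exponent_def by (rule LeastI[of _ n]) (simp add: less_imp_le)
  assume n: "n > 0"
  show "2 ^ fft_exponent n \<le> 2 * n"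
  proof (cases "fft_exponent n")
    case (Suc k)
    then have "\<not> n \<le> 2 ^ k"
      unfolding fft_exponent_def by (metis lessI not_less_Least)
    then show ?thesis using Suc by simp
  qed (use n in simp)
qed

lemma fft_conv_eq:
  assumes "xs \<noteq> []" "ys \<noteq> []"
  shows "fft_conv xs ys =
    map (\<lambda>n. \<Sum>a<length xs. \<Sum>b<length ys. if a + b = n then xs ! a * ys ! b else 0)
      [0..<length xs + length ys - 1]"
proof -
  define n k where "n = length xs + length ys - 1" and "k = fft_exponent n"
  define w where "w = cis (2 * pi / 2 ^ k)"
  define pad :: "real list \<Rightarrow> complex list"
    where "pad zs = map complex_of_real zs @ replicate (2 ^ k - length zs) 0" for zs
  have nk: "n \<le> 2 ^ k" using le_fft_exponent k_def by simp
  have len: "length xs \<le> 2 ^ k" "length ys \<le> 2 ^ k"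
    using assms nk by (cases xs; cases ys; simp add: n_def)+
  have prim: "k > 0 \<Longrightarrow> w ^ 2 ^ (k - 1) = -1"
    unfolding w_def by (rule cis_root_half)
  have prim': "cnj w ^ 2 ^ (k - 1) = -1" if "k > 0"
    using prim[OF that] by (metis complex_cnj_minus complex_cnj_one complex_cnj_power)
  have dft: "fft k w (pad zs) = map (\<lambda>j. \<Sum>a<length zs. zs ! a * w ^ (a * j)) [0..<2 ^ k]"
    if "length zs \<le> 2 ^ k" for zs
  proof -
    have "(\<Sum>a<2 ^ k. pad zs ! a * w ^ (a * j)) = (\<Sum>a<length zs. zs ! a * w ^ (a * j))" for j
      using that by (intro sum.mono_neutral_cong_right) (auto simp: pad_def nth_append)
    then show ?thesis
      by (subst fft_eq_dft) (use that prim in \<open>auto simp: pad_def\<close>)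
  qed
  define pr where "pr = map2 (*) (fft k w (pad xs)) (fft k w (pad ys))"
  have lpr: "length pr = 2 ^ k"
    using len by (simp add: pr_def dft)
  have nth_pr: "pr ! j = (\<Sum>a<length xs. xs ! a * w ^ (a * j)) * (\<Sum>b<length ys. ys ! b * w ^ (b * j))"
    if "j < 2 ^ k" for j
    using that len by (simp add: pr_def dft)
  have inv: "(\<Sum>j<2 ^ k. pr ! j * cnj w ^ (j * i))
      = 2 ^ k * (\<Sum>a<length xs. \<Sum>b<length ys. if a + b = i then xs ! a * ys ! b else 0)"
    if i: "i < n" for i
  proof -
    have orth: "(\<Sum>j<2 ^ k. w ^ (a * j) * w ^ (b * j) * cnj w ^ (j * i)) = (if a + b = i then 2 ^ k else 0)"
      if "a < length xs" "b < length ys" for a b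
    proof -
      let ?d = "int (a + b) - int i"
      have *: "w ^ (a * j) * w ^ (b * j) * cnj w ^ (j * i) = cis (2 * pi * ?d / (2 ^ k :: nat)) ^ j" for j
        unfolding w_def cis_cnj Complex.DeMoivre cis_mult
        by (rule arg_cong[of _ _ cis]) (simp add: field_simps)
      have "\<bar>?d\<bar> < int (2 ^ k)"
      proof -
        have "\<bar>?d\<bar> < int n" using that i by (auto simp: n_def)
        also have "\<dots> \<le> int (2 ^ k)" using nk by (simp only: of_nat_le_iff)
        finally show ?thesis .
      qed
      then show ?thesis
        unfolding * by (subst sum_powers_root_of_unity) auto
    qed
    have "(\<Sum>j<2 ^ k. pr ! j * cnj w ^ (j * i))
      = (\<Sum>j<2 ^ k. \<Sum>a<length xs. \<Sum>b<length ys.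
          xs ! a * ys ! b * (w ^ (a * j) * w ^ (b * j) * cnj w ^ (j * i)))"
      by (intro sum.cong refl,
        simp only: nth_pr lessThan_iff of_real_mult, subst sum_product,
        simp only: sum_distrib_right, simp only: mult_ac)
    also have "\<dots> = (\<Sum>a<length xs. \<Sum>b<length ys. \<Sum>j<2 ^ k.
          xs ! a * ys ! b * (w ^ (a * j) * w ^ (b * j) * cnj w ^ (j * i)))"
      by (subst sum.swap, rule sum.cong[OF refl], rule sum.swap)
    also have "\<dots> = (\<Sum>a<length xs. \<Sum>b<length ys.
          complex_of_real (xs ! a * ys ! b) * (if a + b = i then 2 ^ k else 0))"
      by (intro sum.cong refl) (simp only: sum_distrib_left[symmetric] orth lessThan_iff)
    also have "\<dots> = 2 ^ k * (\<Sum>a<length xs. \<Sum>b<length ys. if a + b = i then xs ! a * ys ! b else 0)"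
      unfolding of_real_sum sum_distrib_left by (intro sum.cong refl) auto
    finally show ?thesis .
  qed
  have "fft_conv xs ys = map (\<lambda>z. Re z / 2 ^ k) (take n (fft k (cnj w) pr))"
    using assms by (simp add: fft_conv_def Let_def n_def k_def w_def pad_def pr_def)
  also have "fft k (cnj w) pr = map (\<lambda>i. \<Sum>j<2 ^ k. pr ! j * cnj w ^ (j * i)) [0..<2 ^ k]"
    by (rule fft_eq_dft) (use lpr prim' in auto)
  also have "take n \<dots> = map (\<lambda>i. \<Sum>j<2 ^ k. pr ! j * cnj w ^ (j * i)) [0..<n]"
    using nk by (simp add: take_map)
  also have "\<dots> = map (\<lambda>i. 2 ^ k * complex_of_real (\<Sum>a<length xs. \<Sum>b<length ys. if a + b = i then xs ! a * ys ! b else 0)) [0..<n]"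
    using inv by (intro map_cong) auto
  finally have conv: "fft_conv xs ys = map (\<lambda>z. Re z / 2 ^ k) \<dots>" .
  have "Re (2 ^ k * complex_of_real x) / 2 ^ k = x" for x
  proof -
    have "2 ^ k * complex_of_real x = complex_of_real (2 ^ k * x)" by simp
    then show ?thesis by (simp only: Re_complex_of_real) simp
  qed
  then show ?thesis
    unfolding conv n_def map_map o_def by (simp only:)
qed

lemma length_fft_conv:
  "length (fft_conv xs ys) = (if xs = [] \<or> ys = [] then 0 else length xs + length ys - 1)"
  by (simp add: fft_conv_eq) (simp add: fft_conv_def)

lemma len_conv: "len (conv A B) = (if len A = 0 \<or> len B = 0 then 0 else len A + len B - 1)"
  by (cases A; cases B) (simp add: length_fft_conv)

definition support :: "grid_array \<Rightarrow> int set" where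
  "support A = {j. entry A j \<noteq> 0}"

lemma support_subset: "support A \<subseteq> {fst A..<fst A + int (len A)}"
  by (cases A) (auto simp: support_def)

lemma finite_support: "finite (support A)"
  by (rule finite_subset[OF support_subset]) simp

lemma sum_entry_shift:
  fixes g :: "int \<Rightarrow> real"
  assumes "finite S" "support A \<subseteq> S"
  shows "(\<Sum>a<len A. snd A ! a * g (fst A + int a)) = (\<Sum>j\<in>S. entry A j * g j)"
proof -
  have "(\<Sum>j\<in>S. entry A j * g j) = (\<Sum>j\<in>{fst A..<fst A + int (len A)}. entry A j * g j)"
  proof -
    have "(\<Sum>j\<in>S. entry A j * g j) = (\<Sum>j\<in>support A. entry A j * g j)"
      using assms by (intro sum.mono_neutral_right) (auto simp: support_def)
    also have "\<dots> = (\<Sum>j\<in>{fst A..<fst A + int (len A)}. entry A j * g j)"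
      using support_subset by (intro sum.mono_neutral_left) (auto simp: support_def)
    finally show ?thesis .
  qed
  also have "\<dots> = (\<Sum>a<len A. snd A ! a * g (fst A + int a))"
    by (rule sum.reindex_bij_witness[of _ "\<lambda>a. fst A + int a" "\<lambda>j. nat (j - fst A)"])
      (cases A; auto)+
  finally show ?thesis by simp
qed

lemma entry_conv:
  assumes "finite S" "support A \<subseteq> S"
  shows "entry (conv A B) j = (\<Sum>a\<in>S. entry A a * entry B (j - a))"
proof (cases "len A = 0 \<or> len B = 0")
  case True
  then have "\<forall>a. entry A a * entry B (j - a) = 0"
    by (cases A; cases B) auto
  moreover have "len (conv A B) = 0"
    using True by (simp add: len_conv)
  then have "entry (conv A B) j = 0"
    by (metis empty_iff support_subset finite_support support_def mem_Collect_eq add.right_neutral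
        atLeastLessThan_empty of_nat_0 order_refl subset_empty)
  ultimately show ?thesis
    by (simp only: sum.neutral_const)
next
  case False
  obtain lo1 xs lo2 ys where AB: "A = (lo1, xs)" "B = (lo2, ys)"
    by (cases A; cases B)
  have ne: "xs \<noteq> []" "ys \<noteq> []"
    using False AB by auto
  have pick: "(\<Sum>b<length ys. if a + b = i then xs ! a * ys ! b else 0)
      = xs ! a * entry B (lo2 + int i - int a)" for a i
  proof -
    have "(\<Sum>b<length ys. if a + b = i then xs ! a * ys ! b else 0)
      = (\<Sum>b<length ys. if b = i - a then (if a \<le> i then xs ! a * ys ! b else 0) else 0)"
      by (intro sum.cong) auto
    also have "\<dots> = xs ! a * entry B (lo2 + int i - int a)"
      by (auto simp: AB sum.delta nat_diff_distrib)
    finally show ?thesis .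
  qed
  have "entry (conv A B) j = (\<Sum>a<length xs. xs ! a * entry B (j - (lo1 + int a)))"
  proof (cases "lo1 + lo2 \<le> j \<and> nat (j - (lo1 + lo2)) < length xs + length ys - 1")
    case True
    then have "entry (conv A B) j = (\<Sum>a<length xs. xs ! a * entry B (lo2 + int (nat (j - (lo1 + lo2))) - int a))"
    proof -
      have "entry (conv A B) j = fft_conv xs ys ! nat (j - (lo1 + lo2))"
        using True ne by (simp add: AB length_fft_conv)
      also have "\<dots> = (\<Sum>a<length xs. xs ! a * entry B (lo2 + int (nat (j - (lo1 + lo2))) - int a))"
        unfolding fft_conv_eq[OF ne] using True by (simp only: nth_map_upt pick) (simp add: pick)
      finally show ?thesis .
    qed
    also have "\<dots> = (\<Sum>a<length xs. xs ! a * entry B (j - (lo1 + int a)))"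
    proof (intro sum.cong refl)
      fix a
      have "lo2 + int (nat (j - (lo1 + lo2))) - int a = j - (lo1 + int a)"
        using True by simp
      then show "xs ! a * entry B (lo2 + int (nat (j - (lo1 + lo2))) - int a)
          = xs ! a * entry B (j - (lo1 + int a))"
        by (simp only:)
    qed
    finally show ?thesis .
  next
    case out: False
    then have "entry (conv A B) j = 0"
      using ne by (auto simp: AB length_fft_conv)
    moreover have "entry B (j - (lo1 + int a)) = 0" if "a < length xs" for a
      using that out ne by (auto simp: AB)
    ultimately show ?thesis by simp
  qed
  also have "\<dots> = (\<Sum>a\<in>S. entry A a * entry B (j - a))"
    using sum_entry_shift[OF assms, of "\<lambda>a. entry B (j - a)"] by (simp add: AB)
  finally show ?thesis .
qed

lemma entry_window: "entry (window \<eta> c h A) j = (if \<bar>of_int j * \<eta> - c\<bar> \<le> h then entry A j else 0)"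
  if "\<eta> > 0"
proof -
  obtain lo xs where A: "A = (lo, xs)" by (cases A)
  define l r where "l = max lo \<lceil>(c - h) / \<eta>\<rceil>"
    and "r = min (lo + int (length xs) - 1) \<lfloor>(c + h) / \<eta>\<rfloor>"
  have W: "window \<eta> c h A = (l, map (\<lambda>j. xs ! nat (j - lo)) [l..r])"
    by (simp add: A l_def r_def Let_def)
  have in_window: "\<lceil>(c - h) / \<eta>\<rceil> \<le> j \<and> j \<le> \<lfloor>(c + h) / \<eta>\<rfloor> \<longleftrightarrow> \<bar>of_int j * \<eta> - c\<bar> \<le> h"
    using that by (auto simp: ceiling_le_iff le_floor_iff field_simps)
  have "entry (window \<eta> c h A) j = (if l \<le> j \<and> j \<le> r then xs ! nat (j - lo) else 0)"
    by (auto simp: W)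
  also have "\<dots> = (if \<bar>of_int j * \<eta> - c\<bar> \<le> h then entry A j else 0)"
    unfolding in_window[symmetric] by (auto simp: A l_def r_def)
  finally show ?thesis .
qed

section \<open>Cost of a merge\<close>

lemma T_fft_eq: "T_fft k = (1 + 3 * k) * 2 ^ k"
  by (induction k) (simp_all add: algebra_simps)

lemma S_fft_le: "S_fft k + 4 \<le> 4 * 2 ^ k"
proof (induction k)
  case (Suc k)
  have "S_fft (Suc k) = S_fft k + 4 * 2 ^ k" "(2::nat) ^ Suc k = 2 * 2 ^ k" by simp_all
  with Suc show ?case by linarith
qed simp

lemma T_conv_le:
  fixes Y :: real
  assumes "real n1 + real n2 \<le> Y" "Y \<ge> 1"
  shows "real (T_conv n1 n2) \<le> 18 * (2 + log 2 Y) * (n1 + n2) + 1"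
proof (cases "n1 = 0 \<or> n2 = 0")
  case True
  then show ?thesis using assms by (simp add: T_conv_def)
next
  case False
  define n k where "n = n1 + n2 - 1" and "k = fft_exponent n"
  have n: "n > 0" "real n \<le> real n1 + real n2" using False by (auto simp: n_def)
  have two: "(2::real) ^ k \<le> 2 * real n"
    using fft_exponent_le[OF n(1)] k_def by (metis of_nat_le_iff of_nat_mult of_nat_numeral of_nat_power)
  have "real k = log 2 (2 ^ k)" by simp
  also have "\<dots> \<le> log 2 (2 * Y)"
    using two n assms by (subst log_le_cancel_iff) auto
  also have "\<dots> = 1 + log 2 Y" using assms by (simp add: log_mult)
  finally have k: "real k \<le> 1 + log 2 Y" .
  have L: "0 \<le> log 2 Y" using assms by simp
  have "T_conv n1 n2 = 3 * T_fft k + 4 * 2 ^ k + 1"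
    using False by (simp add: T_conv_def Let_def n_def k_def)
  then have "real (T_conv n1 n2) = (7 + 9 * real k) * 2 ^ k + 1"
    by (simp add: T_fft_eq algebra_simps)
  also have "\<dots> \<le> (9 * (2 + log 2 Y)) * (2 * (n1 + n2)) + 1"
    using k two n L by (intro add_right_mono mult_mono) auto
  finally show ?thesis by (simp add: algebra_simps)
qed

lemma S_conv_le: "S_conv n1 n2 \<le> 41 * (n1 + n2) + 1"
proof (cases "n1 = 0 \<or> n2 = 0")
  case False
  define n k where "n = n1 + n2 - 1" and "k = fft_exponent n"
  have "S_conv n1 n2 = 12 * 2 ^ k + 2 * S_fft k + n"
    using False by (simp add: S_conv_def Let_def n_def k_def)
  moreover have "2 ^ k \<le> 2 * n"
    using fft_exponent_le[of n] False by (simp add: k_def n_def)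
  ultimately show ?thesis
  proof -
    have "n \<le> n1 + n2" by (simp add: n_def)
    moreover have "S_conv n1 n2 \<le> 20 * 2 ^ k + n"
      using S_fft_le[of k] \<open>S_conv n1 n2 = _\<close> by linarith
    moreover have "20 * 2 ^ k \<le> 20 * (2 * n)"
      using \<open>2 ^ k \<le> 2 * n\<close> by (rule mult_left_mono) simp
    ultimately have "S_conv n1 n2 \<le> 20 * (2 * (n1 + n2)) + (n1 + n2)"
      by (meson add_le_mono mult_le_mono2 order_trans)
    then show ?thesis by simp
  qed
qed (auto simp: S_conv_def)

text \<open>The levels of the tree contribute at most \<open>Y t\<close> each, up to the logarithmic factor of the
  transform.\<close>

lemma T_merge_le:
  fixes Y :: "mtree \<Rightarrow> real"
  assumes len: "\<And>s. real (len (merge H crop s)) + 1 \<le> Y s"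
    and superadd: "\<And>l r. Y l + Y r \<le> Y (Join l r)"
  shows "real (T_merge H crop t) \<le> 20 * (real (depth t) + 1) * (2 + log 2 (Y t)) * Y t"
proof -
  have Y1: "Y s \<ge> 1" for s using len[of s] by simp
  have L0: "0 \<le> log 2 (Y s)" for s using Y1[of s] by simp
  show ?thesis
  proof (induction t)
    case (Coord i)
    have "real (T_merge H crop (Coord i)) \<le> 1 * Y (Coord i)"
      using len[of "Coord i"] by simp
    also have "\<dots> \<le> (20 * (2 + log 2 (Y (Coord i)))) * Y (Coord i)"
      using L0[of "Coord i"] Y1[of "Coord i"] by (intro mult_right_mono) auto
    finally show ?case by simp
  next
    case (Join l r)
    let ?J = "Join l r"
    let ?Q = "2 + log 2 (Y ?J)"
    have le: "Y l \<le> Y ?J" "Y r \<le> Y ?J"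
      using superadd[of l r] Y1[of l] Y1[of r] by linarith+
    have sub: "20 * (real (depth s) + 1) * (2 + log 2 (Y s)) * Y s
        \<le> 20 * real (depth ?J) * ?Q * Y s" if "s \<in> {l, r}" for s
      using that le Y1[of s] L0[of s] by (intro mult_mono) auto
    have n: "real (len (merge H crop l)) + real (len (merge H crop r)) \<le> Y ?J"
      using len[of l] len[of r] superadd[of l r] by linarith
    have IH: "real (T_merge H crop l) \<le> 20 * real (depth ?J) * ?Q * Y l"
      "real (T_merge H crop r) \<le> 20 * real (depth ?J) * ?Q * Y r"
      using order_trans[OF Join.IH(1) sub[of l]] order_trans[OF Join.IH(2) sub[of r]] by simp_all
    have "real (T_merge H crop ?J) = real (T_merge H crop l) + real (T_merge H crop r)
      + real (T_conv (len (merge H crop l)) (len (merge H crop r))) + (real (len (merge H crop ?J)) + 1)"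
      by (simp only: T_merge.simps of_nat_add of_nat_1 add.assoc)
    also have "\<dots> \<le> 20 * real (depth ?J) * ?Q * Y l + 20 * real (depth ?J) * ?Q * Y r
      + (18 * ?Q * (real (len (merge H crop l)) + real (len (merge H crop r))) + 1) + Y ?J"
      using T_conv_le[OF n Y1] by (intro add_mono IH len) simp
    also have "\<dots> = 20 * real (depth ?J) * ?Q * (Y l + Y r)
      + 18 * ?Q * (real (len (merge H crop l)) + real (len (merge H crop r))) + (1 + Y ?J)"
      by (simp only: distrib_left add_ac)
    also have "\<dots> \<le> 20 * real (depth ?J) * ?Q * Y ?J + 18 * ?Q * Y ?J + 2 * ?Q * Y ?J"
    proof (intro add_mono mult_left_mono)
      show "0 \<le> 20 * real (depth ?J) * ?Q" "0 \<le> 18 * ?Q"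
        using L0[of ?J] by (simp_all del: depth.simps)
      have "1 * Y ?J \<le> ?Q * Y ?J"
        using L0[of ?J] Y1[of ?J] by (intro mult_right_mono) auto
      then show "1 + Y ?J \<le> 2 * ?Q * Y ?J"
        using Y1[of ?J] by linarith
    qed (use superadd n in simp_all)
    also have "\<dots> = 20 * (real (depth ?J) + 1) * ?Q * Y ?J"
      by (simp add: algebra_simps del: depth.simps)
    finally show ?case .
  qed
qed

lemma S_merge_resident_le:
  "S_merge (\<lambda>i. words (H i)) H no_crop t \<le> 43 * (\<Sum>i\<leftarrow>coords t. words (H i))"
  "words (merge H no_crop t) \<le> (\<Sum>i\<leftarrow>coords t. words (H i))"
proof (induction t)
  case (Join l r)
  let ?W = "\<lambda>t. \<Sum>i\<leftarrow>coords t. words (H i)"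
  have 1: "words (merge H no_crop (Join l r)) \<le> ?W (Join l r)"
    using Join.IH(2,4) by (simp add: len_conv)
  have "S_conv (len (merge H no_crop l)) (len (merge H no_crop r)) + 81 \<le> 41 * ?W l + 41 * ?W r"
    using S_conv_le[of "len (merge H no_crop l)" "len (merge H no_crop r)"] Join.IH(2,4) by simp
  then have 2: "S_merge (\<lambda>i. words (H i)) H no_crop (Join l r) \<le> 43 * ?W (Join l r)"
    using Join.IH by (simp add: Let_def)
  from 1 2 show "S_merge (\<lambda>i. words (H i)) H no_crop (Join l r) \<le> 43 * ?W (Join l r)"
    and "words (merge H no_crop (Join l r)) \<le> ?W (Join l r)" by blast+
qed auto

lemma S_merge_resident_ge: "(\<Sum>i\<leftarrow>coords t. words (H i)) \<le> S_merge (\<lambda>i. words (H i)) H no_crop t"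
  by (induction t) (auto simp: Let_def)

lemma S_merge_le:
  fixes Y :: "mtree \<Rightarrow> real"
  assumes len: "\<And>s. real (words (merge H crop s)) \<le> Y s"
    and mono: "\<And>l r. Y l \<le> Y (Join l r)" "\<And>l r. Y r \<le> Y (Join l r)"
  shows "real (S_merge (\<lambda>i. 0) H crop t) \<le> 84 * (real (depth t) + 1) * Y t"
proof (induction t)
  case (Coord i)
  then show ?case using len[of "Coord i"] by simp
next
  case (Join l r)
  let ?J = "Join l r" and ?A = "merge H crop l" and ?B = "merge H crop r"
  have Y1: "Y s \<ge> 1" for s using len[of s] by simp
  have IH: "real (S_merge (\<lambda>i. 0) H crop s) \<le> 84 * real (depth ?J) * Y ?J" if "s \<in> {l, r}" for s
  proof -
    have "84 * (real (depth s) + 1) * Y s \<le> 84 * real (depth ?J) * Y ?J"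
      using that mono Y1[of s] by (intro mult_mono) auto
    then show ?thesis using Join.IH that by force
  qed
  have A: "real (words ?A) \<le> Y ?J" "real (words ?B) \<le> Y ?J"
    using len mono by (meson order_trans)+
  have "real (S_conv (len ?A) (len ?B)) \<le> real (41 * (len ?A + len ?B) + 1)"
    using S_conv_le of_nat_le_iff by blast
  then have C: "real (words ?A + words ?B + S_conv (len ?A) (len ?B)) \<le> 84 * Y ?J"
    using A by simp
  have "S_merge (\<lambda>i. 0) H crop ?J = max (S_merge (\<lambda>i. 0) H crop l)
     (max (words ?A + S_merge (\<lambda>i. 0) H crop r) (words ?A + words ?B + S_conv (len ?A) (len ?B)))"
    by (simp add: Let_def)
  moreover have "0 \<le> 84 * real (depth ?J) * Y ?J"
    using Y1[of ?J] by (intro mult_nonneg_nonneg) auto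
  moreover have "84 * (real (depth ?J) + 1) * Y ?J = 84 * real (depth ?J) * Y ?J + 84 * Y ?J"
    by (simp only: distrib_left distrib_right mult_1_right)
  ultimately show ?case
    using IH[of l] IH[of r] A C Y1[of ?J] by (simp only: max_def) (auto simp del: depth.simps)
qed

lemma len_window_le:
  assumes "\<eta> > 0" "h \<ge> 0"
  shows "real (len (window \<eta> c h A)) \<le> 2 * h / \<eta> + 1"
proof (cases A)
  case (Pair lo xs)
  define l r where "l = max lo \<lceil>(c - h) / \<eta>\<rceil>"
    and "r = min (lo + int (length xs) - 1) \<lfloor>(c + h) / \<eta>\<rfloor>"
  have len: "len (window \<eta> c h A) = nat (r - l + 1)"
    by (simp add: Pair l_def r_def Let_def)
  have "real_of_int r \<le> (c + h) / \<eta>" "(c - h) / \<eta> \<le> real_of_int l"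
    by (auto simp: l_def r_def min_le_iff_disj le_max_iff_disj le_floor_iff[symmetric] ceiling_le_iff[symmetric])
  then have "real_of_int (r - l + 1) \<le> (c + h) / \<eta> - (c - h) / \<eta> + 1"
    by simp
  also have "\<dots> = 2 * h / \<eta> + 1" by (simp add: diff_divide_distrib add_divide_distrib)
  finally show ?thesis
    using assms unfolding len by (cases "r - l + 1 \<ge> 0") auto
qed

lemma card_window_le:
  assumes "\<eta> > 0" "h \<ge> 0"
  shows "real (card {j::int. \<bar>of_int j * \<eta> - c\<bar> \<le> h}) \<le> 2 * h / \<eta> + 1"
proof -
  define l r where "l = \<lceil>(c - h) / \<eta>\<rceil>" and "r = \<lfloor>(c + h) / \<eta>\<rfloor>"
  have "{j::int. \<bar>of_int j * \<eta> - c\<bar> \<le> h} = {l..r}"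
    using assms by (auto simp: l_def r_def ceiling_le_iff le_floor_iff field_simps)
  then have card: "card {j::int. \<bar>of_int j * \<eta> - c\<bar> \<le> h} = nat (r - l + 1)"
    by simp
  have "real_of_int r \<le> (c + h) / \<eta>" "(c - h) / \<eta> \<le> real_of_int l"
    by (simp_all add: l_def r_def)
  then have "real_of_int (r - l + 1) \<le> (c + h) / \<eta> - (c - h) / \<eta> + 1"
    by simp
  also have "\<dots> = 2 * h / \<eta> + 1" by (simp add: diff_divide_distrib add_divide_distrib)
  finally show ?thesis
    using assms unfolding card by (cases "r - l + 1 \<ge> 0") auto
qed

lemma coords_nonempty: "coords t \<noteq> []"
  by (induction t) auto

section \<open>Chain laws and block laws\<close>

lemma pmf_tilt:
  assumes fin: "finite (set_pmf \<mu>)"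
  shows "pmf (tilt \<phi> \<mu>) w = exp (\<phi> * w - log_mgf \<mu> \<phi>) * pmf \<mu> w"
proof -
  let ?Z = "\<Sum>w\<in>set_pmf \<mu>. exp (\<phi> * w) * pmf \<mu> w"
  let ?f = "\<lambda>w. exp (\<phi> * w - log_mgf \<mu> \<phi>) * pmf \<mu> w"
  have Z: "?Z > 0"
    using fin by (intro sum_pos) (auto simp: set_pmf_not_empty pmf_positive)
  have "(\<integral>\<^sup>+w. ennreal (?f w) \<partial>count_space UNIV) = (\<Sum>w\<in>set_pmf \<mu>. ennreal (?f w))"
    using fin by (intro nn_integral_count_space'[where A = "set_pmf \<mu>", simplified])
      (auto simp: set_pmf_iff)
  also have "\<dots> = ennreal (\<Sum>w\<in>set_pmf \<mu>. ?f w)"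
    by (rule sum_ennreal) simp
  also have "(\<Sum>w\<in>set_pmf \<mu>. ?f w) = ?Z / exp (log_mgf \<mu> \<phi>)"
    by (simp add: exp_diff sum_divide_distrib)
  also have "\<dots> = 1"
    using Z by (simp add: log_mgf_def)
  finally show ?thesis
    unfolding tilt_def by (intro pmf_embed_pmf) auto
qed

lemma set_pmf_tilt: "finite (set_pmf \<mu>) \<Longrightarrow> set_pmf (tilt \<phi> \<mu>) = set_pmf \<mu>"
  by (auto simp: set_pmf_iff pmf_tilt)

lemma set_pmf_atom_pmf: "finite (set_pmf q) \<Longrightarrow> set_pmf (atom_pmf ch q) = set_pmf q"
  by (cases ch) (auto simp: set_pmf_not_empty)

lemma set_pmf_chain_law:
  "finite (alphabet p i) \<Longrightarrow> set_pmf (chain_law ch \<phi> p st i) = st i ` alphabet p i"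
  by (simp add: chain_law_def set_pmf_tilt set_pmf_atom_pmf)

lemma expectation_chain_law:
  fixes f :: "real \<Rightarrow> real"
  assumes fin: "finite (alphabet p i)"
  shows "measure_pmf.expectation (chain_law ch \<phi> p st i) f
    = (\<Sum>a\<in>alphabet p i. atom_weight ch \<phi> p st i a * f (st i a))"
proof -
  let ?q = "atom_pmf ch (p i)"
  let ?\<mu> = "map_pmf (st i) ?q"
  let ?e = "\<lambda>w. exp (\<phi> * w - log_mgf ?\<mu> \<phi>)"
  have fin\<mu>: "finite (set_pmf ?\<mu>)" using fin by (simp add: set_pmf_atom_pmf)
  have "measure_pmf.expectation (chain_law ch \<phi> p st i) f
    = (\<Sum>w\<in>set_pmf ?\<mu>. f w * pmf (tilt \<phi> ?\<mu>) w)"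
    unfolding chain_law_def using fin\<mu> by (intro integral_measure_pmf_real) (simp_all add: set_pmf_tilt)
  also have "\<dots> = (\<Sum>w\<in>set_pmf ?\<mu>. (f w * ?e w) * pmf ?\<mu> w)"
    by (simp only: pmf_tilt[OF fin\<mu>] mult.assoc)
  also have "\<dots> = measure_pmf.expectation ?\<mu> (\<lambda>w. f w * ?e w)"
    using fin\<mu> by (intro integral_measure_pmf_real[symmetric]) auto
  also have "\<dots> = measure_pmf.expectation ?q (\<lambda>a. f (st i a) * ?e (st i a))"
    by (rule integral_map_pmf)
  also have "\<dots> = (\<Sum>a\<in>alphabet p i. (f (st i a) * ?e (st i a)) * pmf ?q a)"
    using fin by (intro integral_measure_pmf_real) (auto simp: set_pmf_atom_pmf)
  finally show ?thesis by (simp add: atom_weight_def mult_ac)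
qed

lemma sum_atom_weight:
  assumes "finite (alphabet p i)"
  shows "(\<Sum>a\<in>alphabet p i. atom_weight ch \<phi> p st i a) = 1"
  using expectation_chain_law[where p = p and i = i and ch = ch and \<phi> = \<phi> and st = st and f = "\<lambda>_. 1"]
    assms by simp

lemma atom_weight_nonneg: "0 \<le> atom_weight ch \<phi> p st i a"
  by (simp add: atom_weight_def)

lemma atom_weight_le_1:
  assumes "finite (alphabet p i)" "a \<in> alphabet p i"
  shows "atom_weight ch \<phi> p st i a \<le> 1"
  using member_le_sum[OF assms(2), of "atom_weight ch \<phi> p st i"] assms sum_atom_weight[where p = p and i = i]
  by (simp add: atom_weight_nonneg)

definition grid_supported :: "real \<Rightarrow> real pmf \<Rightarrow> bool" where
  "grid_supported \<eta> \<mu> \<longleftrightarrow> finite (set_pmf \<mu>) \<and> (\<forall>w\<in>set_pmf \<mu>. \<exists>j::int. w = of_int j * \<eta>)"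

lemma grid_supportedD: "grid_supported \<eta> \<mu> \<Longrightarrow> w \<in> set_pmf \<mu> \<Longrightarrow> \<exists>j::int. w = of_int j * \<eta>"
  by (simp add: grid_supported_def)

definition grid_indices :: "real \<Rightarrow> real pmf \<Rightarrow> int set" where
  "grid_indices \<eta> \<mu> = {j::int. of_int j * \<eta> \<in> set_pmf \<mu>}"

lemma grid_indices:
  assumes "\<eta> > 0" "grid_supported \<eta> \<mu>"
  shows finite_grid_indices: "finite (grid_indices \<eta> \<mu>)"
    and set_pmf_grid: "set_pmf \<mu> = (\<lambda>j. of_int j * \<eta>) ` grid_indices \<eta> \<mu>"
proof -
  show set: "set_pmf \<mu> = (\<lambda>j. of_int j * \<eta>) ` grid_indices \<eta> \<mu>"
    using assms(2) by (auto simp: grid_supported_def grid_indices_def)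
  have "inj_on (\<lambda>j::int. of_int j * \<eta>) (grid_indices \<eta> \<mu>)"
    using assms(1) by (auto simp: inj_on_def)
  then show "finite (grid_indices \<eta> \<mu>)"
    using set assms(2) by (metis finite_imageD grid_supported_def)
qed

lemma entry_histogram:
  assumes "\<eta> > 0" "grid_supported \<eta> \<mu>"
  shows "entry (histogram \<eta> \<mu>) j = pmf \<mu> (of_int j * \<eta>)"
proof -
  let ?J = "grid_indices \<eta> \<mu>"
  have "pmf \<mu> (of_int j * \<eta>) = 0" if "\<not> (Min ?J \<le> j \<and> j \<le> Max ?J)"
  proof -
    have "j \<notin> ?J" using that finite_grid_indices[OF assms] by auto
    then show ?thesis by (simp add: grid_indices_def set_pmf_iff)
  qed
  moreover have "nat (j - Min ?J) < nat (Max ?J - Min ?J + 1) \<longleftrightarrow> j \<le> Max ?J" if "Min ?J \<le> j"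
    using that by auto
  ultimately show ?thesis
    unfolding histogram_def grid_indices_def[symmetric] Let_def by (auto simp: Let_def)
qed

lemma sum_pmf_grid:
  fixes f :: "real \<Rightarrow> real"
  assumes "\<eta> > 0" "grid_supported \<eta> \<mu>" "finite S" "grid_indices \<eta> \<mu> \<subseteq> S"
  shows "measure_pmf.expectation \<mu> f = (\<Sum>j\<in>S. f (of_int j * \<eta>) * pmf \<mu> (of_int j * \<eta>))"
proof -
  have inj: "inj_on (\<lambda>j::int. of_int j * \<eta>) A" for A
    using assms(1) by (auto simp: inj_on_def)
  have "measure_pmf.expectation \<mu> f = (\<Sum>w\<in>(\<lambda>j. of_int j * \<eta>) ` S. f w * pmf \<mu> w)"
    using assms set_pmf_grid[OF assms(1,2)] by (intro integral_measure_pmf_real) auto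
  then show ?thesis by (simp add: sum.reindex[OF inj])
qed

lemma block_law_union:
  assumes "finite A" "finite B" "A \<inter> B = {}"
  shows "block_law \<mu> (A \<union> B) = map_pmf (\<lambda>(x, y). x + y) (pair_pmf (block_law \<mu> A) (block_law \<mu> B))"
proof -
  have "(\<Sum>i\<in>A \<union> B. if i \<in> A then f i else g i) = sum f A + sum g B" for f g :: "nat \<Rightarrow> real"
  proof -
    have "(\<Sum>i\<in>A \<union> B. if i \<in> A then f i else g i)
      = (\<Sum>i\<in>A. if i \<in> A then f i else g i) + (\<Sum>i\<in>B. if i \<in> A then f i else g i)"
      using assms by (intro sum.union_disjoint) auto
    also have "\<dots> = sum f A + sum g B"
      using assms by (intro arg_cong2[of _ _ _ _ "(+)"] sum.cong) auto
    finally show ?thesis .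
  qed
  then show ?thesis
    unfolding block_law_def Pi_pmf_union[OF assms] map_pair[symmetric] pmf.map_comp
    by (intro map_pmf_cong refl) auto
qed

lemma block_law_singleton: "block_law \<mu> {i} = \<mu> i"
  by (simp add: block_law_def Pi_pmf_singleton pmf.map_comp o_def)

lemma grid_supported_block_law:
  assumes "finite I" "\<And>i. i \<in> I \<Longrightarrow> grid_supported \<eta> (\<mu> i)"
  shows "grid_supported \<eta> (block_law \<mu> I)"
  using assms
proof (induction I rule: finite_induct)
  case empty
  show ?case by (auto simp: block_law_def grid_supported_def intro: exI[of _ 0])
next
  case (insert i I)
  have B: "block_law \<mu> (insert i I) = map_pmf (\<lambda>(x, y). x + y) (pair_pmf (\<mu> i) (block_law \<mu> I))"
    using block_law_union[of "{i}" I \<mu>] insert by (simp add: block_law_singleton)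
  have gi: "grid_supported \<eta> (\<mu> i)" and gI: "grid_supported \<eta> (block_law \<mu> I)"
    using insert by auto
  have "\<exists>j::int. x + y = of_int j * \<eta>" if x: "x \<in> set_pmf (\<mu> i)" and y: "y \<in> set_pmf (block_law \<mu> I)" for x y
  proof -
    obtain j :: int where "x = of_int j * \<eta>"
      using grid_supportedD[OF gi x] by blast
    moreover obtain k :: int where "y = of_int k * \<eta>"
      using grid_supportedD[OF gI y] by blast
    ultimately show ?thesis by (intro exI[of _ "j + k"]) (simp add: distrib_right)
  qed
  then show ?case
    using gi gI unfolding B grid_supported_def by auto
qed

lemma pmf_block_law_union:
  assumes \<eta>: "\<eta> > 0" and AB: "finite A" "finite B" "A \<inter> B = {}"
    and grid: "\<And>i. i \<in> A \<Longrightarrow> grid_supported \<eta> (\<mu> i)"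
    and S: "finite S" "grid_indices \<eta> (block_law \<mu> A) \<subseteq> S"
  shows "pmf (block_law \<mu> (A \<union> B)) (of_int j * \<eta>)
    = (\<Sum>a\<in>S. pmf (block_law \<mu> A) (of_int a * \<eta>) * pmf (block_law \<mu> B) (of_int (j - a) * \<eta>))"
proof -
  let ?w = "of_int j * \<eta>"
  have "block_law \<mu> (A \<union> B) = bind_pmf (block_law \<mu> A) (\<lambda>x. map_pmf (\<lambda>y. x + y) (block_law \<mu> B))"
    by (simp add: block_law_union[OF AB] pair_pmf_def map_bind_pmf map_pmf_def bind_assoc_pmf bind_return_pmf)
  moreover have "pmf (map_pmf (\<lambda>y. x + y) (block_law \<mu> B)) ?w = pmf (block_law \<mu> B) (?w - x)" for x
    using pmf_map_inj'[of "\<lambda>y. x + y" "block_law \<mu> B" "?w - x"] by simp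
  ultimately have "pmf (block_law \<mu> (A \<union> B)) ?w
      = measure_pmf.expectation (block_law \<mu> A) (\<lambda>x. pmf (block_law \<mu> B) (?w - x))"
    by (simp add: pmf_bind)
  also have "measure_pmf.expectation (block_law \<mu> A) (\<lambda>x. pmf (block_law \<mu> B) (?w - x))
    = (\<Sum>a\<in>S. pmf (block_law \<mu> B) (?w - of_int a * \<eta>) * pmf (block_law \<mu> A) (of_int a * \<eta>))"
    using \<eta> S grid_supported_block_law[OF AB(1) grid] by (intro sum_pmf_grid) auto
  finally show ?thesis by (simp add: algebra_simps)
qed

lemma entry_merge_full:
  assumes \<eta>: "\<eta> > 0" and "distinct (coords t)"
    and "\<And>i. i \<in> set (coords t) \<Longrightarrow> grid_supported \<eta> (\<mu> i)"
  shows "entry (merge (\<lambda>i. histogram \<eta> (\<mu> i)) no_crop t) j = pmf (block_law \<mu> (set (coords t))) (of_int j * \<eta>)"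
  using assms(2,3)
proof (induction t arbitrary: j)
  case (Coord i)
  then show ?case using \<eta> by (simp add: entry_histogram block_law_singleton)
next
  case (Join l r)
  let ?M = "merge (\<lambda>i. histogram \<eta> (\<mu> i)) no_crop"
  have l: "entry (?M l) j = pmf (block_law \<mu> (set (coords l))) (of_int j * \<eta>)" for j
    using Join by auto
  have r: "entry (?M r) j = pmf (block_law \<mu> (set (coords r))) (of_int j * \<eta>)" for j
    using Join by auto
  have "grid_indices \<eta> (block_law \<mu> (set (coords l))) = support (?M l)"
    by (auto simp: grid_indices_def support_def l set_pmf_iff)
  then have "pmf (block_law \<mu> (set (coords l) \<union> set (coords r))) (of_int j * \<eta>)
    = (\<Sum>a\<in>support (?M l). entry (?M l) a * entry (?M r) (j - a))"
    unfolding l r using Join.prems finite_support \<eta> by (intro pmf_block_law_union) auto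
  then show ?case
    by (simp only: merge.simps coords.simps set_append entry_conv[OF finite_support order_refl])
qed

lemma setting_grid_index:
  assumes "setting m \<eta> p st" "i < m"
  shows "\<exists>d::int. \<forall>a\<in>alphabet p i. st i a = of_int (\<lfloor>surprisal p i a / \<eta>\<rfloor> + d) * \<eta>"
proof -
  have \<eta>: "\<eta> > 0" using assms by (simp add: setting_def)
  consider "\<forall>a\<in>alphabet p i. st i a = \<eta> * of_int (\<lfloor>surprisal p i a / \<eta>\<rfloor> + 1)"
    | "\<forall>a\<in>alphabet p i. (\<exists>j::int. surprisal p i a = \<eta> * of_int j) \<and> st i a = surprisal p i a"
    using assms unfolding setting_def grid_surprisals_def by blast
  then show ?thesis
  proof cases
    case 1
    then show ?thesis by (intro exI[of _ 1]) (simp add: mult.commute)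
  next
    case 2
    have "st i a = of_int (\<lfloor>surprisal p i a / \<eta>\<rfloor> + 0) * \<eta>" if a: "a \<in> alphabet p i" for a
    proof -
      obtain j :: int where "surprisal p i a = \<eta> * of_int j" "st i a = surprisal p i a"
        using 2 a by blast
      then show ?thesis using \<eta> by simp
    qed
    then show ?thesis by blast
  qed
qed

lemma grid_supported_chain_law:
  assumes "setting m \<eta> p st" "i < m"
  shows "grid_supported \<eta> (chain_law ch \<phi> p st i)"
proof -
  have "finite (alphabet p i)" using assms by (simp add: setting_def)
  then show ?thesis
    using setting_grid_index[OF assms] by (auto simp: grid_supported_def set_pmf_chain_law simp del: of_int_add)
qed

lemma len_histogram_chain_law:
  fixes ch :: chain and \<phi> :: real
  assumes "setting m \<eta> p st" "i < m"
  defines "n \<equiv> real (len (histogram \<eta> (chain_law ch \<phi> p st i)))"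
    and "\<rho> \<equiv> Max (surprisal p i ` alphabet p i) - Min (surprisal p i ` alphabet p i)"
  shows "\<rho> / \<eta> \<le> n" "n \<le> \<rho> / \<eta> + 2" "\<rho> \<ge> 0"
proof -
  have \<eta>: "\<eta> > 0" and fin: "finite (alphabet p i)" using assms by (simp_all add: setting_def)
  obtain d :: int where d: "\<And>a. a \<in> alphabet p i \<Longrightarrow> st i a = of_int (\<lfloor>surprisal p i a / \<eta>\<rfloor> + d) * \<eta>"
    using setting_grid_index[OF assms(1,2)] by blast
  define f where "f x = \<lfloor>x / \<eta>\<rfloor> + d" for x
  let ?S = "surprisal p i ` alphabet p i"
  have S: "finite ?S" "?S \<noteq> {}" using fin set_pmf_not_empty by auto
  have mono: "mono f"
    using \<eta> by (auto simp: mono_def f_def intro!: floor_mono divide_right_mono)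
  have J: "{j::int. of_int j * \<eta> \<in> set_pmf (chain_law ch \<phi> p st i)} = f ` ?S"
    using \<eta> d by (auto simp: fin set_pmf_chain_law[where p = p and i = i] f_def image_iff simp del: of_int_add)
  have le: "Min ?S \<le> Max ?S" using S by (simp add: Max_ge_iff)
  then have le': "f (Min ?S) \<le> f (Max ?S)" using mono by (simp add: monoD)
  have "n = real_of_int (f (Max ?S) - f (Min ?S) + 1)"
    using le' unfolding n_def histogram_def J Let_def
    by (simp add: mono_Max_commute[OF mono S, symmetric] mono_Min_commute[OF mono S, symmetric])
  then have n: "n = real_of_int \<lfloor>Max ?S / \<eta>\<rfloor> - real_of_int \<lfloor>Min ?S / \<eta>\<rfloor> + 1"
    by (simp add: f_def)
  have \<rho>: "\<rho> / \<eta> = Max ?S / \<eta> - Min ?S / \<eta>" by (simp add: \<rho>_def diff_divide_distrib)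
  show "\<rho> \<ge> 0" using le by (simp add: \<rho>_def)
  show "\<rho> / \<eta> \<le> n" "n \<le> \<rho> / \<eta> + 2"
    unfolding n \<rho> by linarith+
qed

section \<open>Truncation\<close>

definition gmass :: "grid_array \<Rightarrow> real" where
  "gmass A = (\<Sum>j\<in>support A. entry A j)"

lemma gmass_eq: "finite S \<Longrightarrow> support A \<subseteq> S \<Longrightarrow> gmass A = (\<Sum>j\<in>S. entry A j)"
  unfolding gmass_def by (intro sum.mono_neutral_left) (auto simp: support_def)

lemma gmass_conv: "gmass (conv A B) = gmass A * gmass B"
proof -
  define S where "S = (\<lambda>(a, b). a + b) ` (support A \<times> support B)"
  have S: "finite S" by (simp add: S_def finite_support)
  have conv: "entry (conv A B) j = (\<Sum>a\<in>support A. entry A a * entry B (j - a))" for j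
    by (rule entry_conv[OF finite_support order_refl])
  have "support (conv A B) \<subseteq> S"
  proof
    fix j assume "j \<in> support (conv A B)"
    then have "(\<Sum>a\<in>support A. entry A a * entry B (j - a)) \<noteq> 0"
      by (simp add: support_def[of "conv A B"] conv)
    then obtain a where "a \<in> support A" "entry A a * entry B (j - a) \<noteq> 0"
      by (meson sum.neutral)
    then have "(a, j - a) \<in> support A \<times> support B" by (simp add: support_def)
    then have "(\<lambda>(a, b). a + b) (a, j - a) \<in> S" unfolding S_def by (rule imageI)
    then show "j \<in> S" by simp
  qed
  then have "gmass (conv A B) = (\<Sum>j\<in>S. \<Sum>a\<in>support A. entry A a * entry B (j - a))"
    using S by (simp add: gmass_eq conv)
  also have "\<dots> = (\<Sum>a\<in>support A. entry A a * (\<Sum>j\<in>S. entry B (j - a)))"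
    by (subst sum.swap) (simp add: sum_distrib_left)
  also have "\<dots> = (\<Sum>a\<in>support A. entry A a * gmass B)"
  proof (intro sum.cong refl arg_cong2[of _ _ _ _ "(*)"])
    fix a assume a: "a \<in> support A"
    have sub: "support B \<subseteq> (\<lambda>j. j - a) ` S"
    proof
      fix b assume "b \<in> support B"
      then have "(\<lambda>(a, b). a + b) (a, b) \<in> S" unfolding S_def using a by (intro imageI) simp
      then show "b \<in> (\<lambda>j. j - a) ` S" by (auto intro: image_eqI[of _ _ "a + b"])
    qed
    have "(\<Sum>j\<in>S. entry B (j - a)) = (\<Sum>b\<in>(\<lambda>j. j - a) ` S. entry B b)"
      by (subst sum.reindex) (auto simp: inj_on_def)
    also have "\<dots> = gmass B" using S sub by (subst gmass_eq) auto
    finally show "(\<Sum>j\<in>S. entry B (j - a)) = gmass B" .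
  qed
  finally show ?thesis by (simp add: gmass_def sum_distrib_right)
qed

definition dominated :: "real \<Rightarrow> real pmf \<Rightarrow> grid_array \<Rightarrow> bool" where
  "dominated \<eta> \<nu> A \<longleftrightarrow> (\<forall>j. 0 \<le> entry A j \<and> entry A j \<le> pmf \<nu> (of_int j * \<eta>))"

lemma dominated_support: "dominated \<eta> \<nu> A \<Longrightarrow> support A \<subseteq> grid_indices \<eta> \<nu>"
proof
  fix j assume "dominated \<eta> \<nu> A" "j \<in> support A"
  then have "0 < pmf \<nu> (of_int j * \<eta>)"
    unfolding dominated_def support_def by (metis (mono_tags) mem_Collect_eq order_le_imp_less_or_eq order_less_le_trans)
  then show "j \<in> grid_indices \<eta> \<nu>" by (simp add: grid_indices_def set_pmf_iff)
qed

lemma dominated_window: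
  "\<eta> > 0 \<Longrightarrow> dominated \<eta> \<nu> A \<Longrightarrow> dominated \<eta> \<nu> (window \<eta> c h A)"
  by (simp add: dominated_def entry_window)

lemma gmass_window_ge:
  assumes \<eta>: "\<eta> > 0" and dom: "dominated \<eta> \<nu> A"
  shows "gmass A - measure_pmf.prob \<nu> {w. \<not> \<bar>w - c\<bar> \<le> h} \<le> gmass (window \<eta> c h A)"
proof -
  let ?in = "\<lambda>j::int. \<bar>of_int j * \<eta> - c\<bar> \<le> h"
  let ?T = "{j \<in> support A. \<not> ?in j}"
  have fin: "finite (support A)" by (rule finite_support)
  have "gmass (window \<eta> c h A) = (\<Sum>j\<in>support A. if ?in j then entry A j else 0)"
    using fin \<eta> by (subst gmass_eq[of "support A"]) (auto simp: support_def entry_window)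
  moreover have "gmass A = (\<Sum>j\<in>support A. (if ?in j then entry A j else 0) + (if \<not> ?in j then entry A j else 0))"
    unfolding gmass_def by (intro sum.cong) auto
  ultimately have "gmass A - gmass (window \<eta> c h A) = (\<Sum>j\<in>support A. if \<not> ?in j then entry A j else 0)"
    by (simp add: sum.distrib)
  also have "\<dots> = (\<Sum>j\<in>?T. entry A j)"
    using fin by (simp add: sum.inter_filter)
  also have "\<dots> \<le> (\<Sum>j\<in>?T. pmf \<nu> (of_int j * \<eta>))"
    using dom by (intro sum_mono) (auto simp: dominated_def)
  also have "\<dots> = measure_pmf.prob \<nu> ((\<lambda>j. of_int j * \<eta>) ` ?T)"
    using fin \<eta> by (subst measure_measure_pmf_finite) (auto simp: sum.reindex inj_on_def)
  also have "\<dots> \<le> measure_pmf.prob \<nu> {w. \<not> \<bar>w - c\<bar> \<le> h}"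
    by (intro measure_pmf.finite_measure_mono) auto
  finally show ?thesis by simp
qed

lemma dominated_conv:
  assumes "\<eta> > 0" "finite I" "finite J" "I \<inter> J = {}" "\<And>i. i \<in> I \<Longrightarrow> grid_supported \<eta> (\<mu> i)"
    and A: "dominated \<eta> (block_law \<mu> I) A" and B: "dominated \<eta> (block_law \<mu> J) B"
  shows "dominated \<eta> (block_law \<mu> (I \<union> J)) (conv A B)"
proof -
  let ?S = "grid_indices \<eta> (block_law \<mu> I)"
  have fin: "finite ?S"
    using assms by (intro finite_grid_indices grid_supported_block_law)
  have "entry (conv A B) j = (\<Sum>a\<in>?S. entry A a * entry B (j - a))" for j
    by (rule entry_conv[OF fin dominated_support[OF A]])
  moreover have "pmf (block_law \<mu> (I \<union> J)) (of_int j * \<eta>) = (\<Sum>a\<in>?S. pmf (block_law \<mu> I) (of_int a * \<eta>)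
      * pmf (block_law \<mu> J) (of_int (j - a) * \<eta>))" for j
    using assms fin by (intro pmf_block_law_union) auto
  moreover have "0 \<le> (\<Sum>a\<in>?S. entry A a * entry B (j - a))" for j
    using A B by (intro sum_nonneg mult_nonneg_nonneg) (auto simp: dominated_def)
  moreover have "(\<Sum>a\<in>?S. entry A a * entry B (j - a)) \<le> (\<Sum>a\<in>?S. pmf (block_law \<mu> I) (of_int a * \<eta>)
      * pmf (block_law \<mu> J) (of_int (j - a) * \<eta>))" for j
    using A B unfolding dominated_def by (intro sum_mono mult_mono) (auto simp del: of_int_diff)
  ultimately show ?thesis by (simp only: dominated_def) blast
qed

text \<open>Each of the \<open>2 n - 1\<close> nodes loses at most the mass outside its window, because the truncated
  array stays below the exact law.\<close>

lemma merge_truncated: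
  fixes \<mu> :: "nat \<Rightarrow> real pmf"
  assumes \<eta>: "\<eta> > 0" and t: "distinct (coords t)" "set (coords t) \<subseteq> D"
    and grid: "\<And>i. i \<in> D \<Longrightarrow> grid_supported \<eta> (\<mu> i)"
    and tail: "\<And>I. I \<subseteq> D \<Longrightarrow> I \<noteq> {} \<Longrightarrow> finite I \<Longrightarrow>
      measure_pmf.prob (block_law \<mu> I) {w. \<not> \<bar>w - c I\<bar> \<le> h I} \<le> \<delta>"
  defines "A \<equiv> \<lambda>t. merge (\<lambda>i. histogram \<eta> (\<mu> i)) (\<lambda>I. window \<eta> (c I) (h I)) t"
  shows "dominated \<eta> (block_law \<mu> (set (coords t))) (A t) \<and>
    1 - (2 * real (length (coords t)) - 1) * \<delta> \<le> gmass (A t) \<and> gmass (A t) \<le> 1"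
  using t
proof (induction t)
  case (Coord i)
  let ?H = "histogram \<eta> (\<mu> i)"
  have i: "grid_supported \<eta> (\<mu> i)" using Coord grid by auto
  have dom: "dominated \<eta> (\<mu> i) ?H"
    using i \<eta> by (simp add: dominated_def entry_histogram)
  have "gmass ?H = (\<Sum>j\<in>grid_indices \<eta> (\<mu> i). entry ?H j)"
    using finite_grid_indices[OF \<eta> i] dominated_support[OF dom] by (rule gmass_eq)
  also have "\<dots> = 1"
    using sum_pmf_grid[OF \<eta> i finite_grid_indices[OF \<eta> i] order_refl, of "\<lambda>_. 1"]
    by (simp add: entry_histogram[OF \<eta> i])
  finally have mass: "gmass ?H = 1" .
  have "gmass (A (Coord i)) \<ge> 1 - \<delta>"
    using gmass_window_ge[OF \<eta> dom, of "c {i}" "h {i}"] tail[of "{i}"] Coord mass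
    by (simp add: A_def block_law_singleton)
  moreover have dA: "dominated \<eta> (\<mu> i) (A (Coord i))"
    using dominated_window[OF \<eta> dom] by (simp add: A_def)
  moreover have "gmass (A (Coord i)) \<le> 1"
  proof -
    have "gmass (A (Coord i)) = (\<Sum>j\<in>grid_indices \<eta> (\<mu> i). entry (A (Coord i)) j)"
      using finite_grid_indices[OF \<eta> i] dominated_support[OF dA] by (rule gmass_eq)
    also have "\<dots> \<le> (\<Sum>j\<in>grid_indices \<eta> (\<mu> i). entry ?H j)"
      using dA by (intro sum_mono) (auto simp: dominated_def entry_histogram[OF \<eta> i])
    finally show ?thesis
      using mass finite_grid_indices[OF \<eta> i] dominated_support[OF dom] by (simp add: gmass_eq)
  qed
  ultimately show ?case by (simp add: block_law_singleton)
next
  case (Join l r)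
  let ?I = "set (coords l)" and ?J = "set (coords r)"
  let ?X = "conv (A l) (A r)"
  have IHl: "dominated \<eta> (block_law \<mu> ?I) (A l)" "1 - (2 * real (length (coords l)) - 1) * \<delta> \<le> gmass (A l)" "gmass (A l) \<le> 1"
    and IHr: "dominated \<eta> (block_law \<mu> ?J) (A r)" "1 - (2 * real (length (coords r)) - 1) * \<delta> \<le> gmass (A r)" "gmass (A r) \<le> 1"
    using Join by auto
  have dom: "dominated \<eta> (block_law \<mu> (?I \<union> ?J)) ?X"
    using Join.prems \<eta> grid IHl(1) IHr(1) by (intro dominated_conv) auto
  have A: "A (Join l r) = window \<eta> (c (?I \<union> ?J)) (h (?I \<union> ?J)) ?X"
    by (simp add: A_def)
  have nonneg: "0 \<le> gmass B" if "dominated \<eta> \<nu> B" for \<nu> B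
    using that by (auto simp: gmass_def dominated_def intro: sum_nonneg)
  have "gmass (A l) * gmass (A r) \<ge> gmass (A l) + gmass (A r) - 1"
  proof -
    have "0 \<le> (1 - gmass (A l)) * (1 - gmass (A r))"
      using IHl(3) IHr(3) by (intro mult_nonneg_nonneg) auto
    then show ?thesis by (simp add: algebra_simps)
  qed
  then have X: "gmass ?X \<ge> gmass (A l) + gmass (A r) - 1" by (simp add: gmass_conv)
  have "gmass ?X \<le> 1"
    using IHl(3) IHr(3) nonneg[OF IHl(1)] nonneg[OF IHr(1)] by (simp add: gmass_conv mult_le_one)
  moreover have "gmass (A (Join l r)) \<le> gmass ?X"
  proof -
    have "gmass (A (Join l r)) = (\<Sum>j\<in>support ?X. entry (A (Join l r)) j)"
      unfolding A using \<eta> by (intro gmass_eq finite_support) (auto simp: support_def entry_window)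
    also have "\<dots> \<le> (\<Sum>j\<in>support ?X. entry ?X j)"
      unfolding A using \<eta> dom by (intro sum_mono) (auto simp: entry_window dominated_def)
    finally show ?thesis by (simp add: gmass_def)
  qed
  moreover have "gmass ?X - \<delta> \<le> gmass (A (Join l r))"
    using gmass_window_ge[OF \<eta> dom, of "c (?I \<union> ?J)" "h (?I \<union> ?J)"] tail[of "?I \<union> ?J"] Join.prems coords_nonempty[of l]
    unfolding A by force
  moreover have "dominated \<eta> (block_law \<mu> (?I \<union> ?J)) (A (Join l r))"
    unfolding A by (rule dominated_window[OF \<eta> dom])
  ultimately show ?case
    using X IHl(2) IHr(2) by (simp add: algebra_simps)
qed

lemma l1_dist_dominated:
  assumes \<eta>: "\<eta> > 0" and \<nu>: "grid_supported \<eta> \<nu>"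
    and A: "dominated \<eta> \<nu> A" and F: "\<And>j. entry F j = pmf \<nu> (of_int j * \<eta>)"
  shows "l1_dist A F = 1 - gmass A"
proof -
  let ?S = "grid_indices \<eta> \<nu>"
  have fin: "finite ?S" by (rule finite_grid_indices[OF \<eta> \<nu>])
  have "{j. entry A j \<noteq> 0 \<or> entry F j \<noteq> 0} = ?S"
    using dominated_support[OF A] by (auto simp: support_def F grid_indices_def set_pmf_iff)
  then have "l1_dist A F = (\<Sum>j\<in>?S. pmf \<nu> (of_int j * \<eta>) - entry A j)"
    unfolding l1_dist_def using A by (intro sum.cong) (auto simp: F dominated_def)
  also have "\<dots> = 1 - gmass A"
    using sum_pmf_grid[OF \<eta> \<nu> fin order_refl, of "\<lambda>_. 1"] gmass_eq[OF fin dominated_support[OF A]]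
    by (simp add: sum_subtractf)
  finally show ?thesis .
qed

section \<open>Concentration of decaying chains\<close>

lemma exp_le_quadratic: "exp x \<le> 1 + x + x\<^sup>2 * exp \<bar>x\<bar>" for x :: real
proof -
  obtain t where t: "\<bar>t\<bar> \<le> \<bar>x\<bar>" "exp x = (\<Sum>m<2. x ^ m / fact m) + exp t / fact 2 * x ^ 2"
    using Maclaurin_exp_le[of x 2] by blast
  have "exp t / 2 \<le> exp \<bar>x\<bar>"
    using t(1) by (smt (verit) exp_gt_zero exp_le_cancel_iff field_sum_of_halves)
  then have "exp t / 2 * x\<^sup>2 \<le> exp \<bar>x\<bar> * x\<^sup>2"
    by (intro mult_right_mono) auto
  then show ?thesis
    using t(2) by (simp add: numeral_2_eq_2 mult.commute)
qed

lemma quadratic_exp_le: "0 \<le> u \<Longrightarrow> u\<^sup>2 * exp (- u / 4) \<le> 64" for u :: real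
proof -
  assume u: "0 \<le> u"
  have "u / 8 \<le> exp (u / 8)"
    using exp_ge_add_one_self[of "u / 8"] by linarith
  then have "(u / 8)\<^sup>2 \<le> (exp (u / 8))\<^sup>2"
    using u by (intro power_mono) auto
  also have "(exp (u / 8))\<^sup>2 = exp (u / 4)"
    by (simp add: power2_eq_square exp_add[symmetric])
  finally have "u\<^sup>2 \<le> 64 * exp (u / 4)"
    by (simp add: power_divide)
  then have "u\<^sup>2 * exp (- u / 4) \<le> 64 * exp (u / 4) * exp (- u / 4)"
    by (intro mult_right_mono) auto
  then show ?thesis by (simp add: mult.assoc exp_add[symmetric])
qed

lemma chain_law_mgf_le:
  assumes fin: "finite (alphabet p i)"
    and decay: "\<And>a. a \<in> alphabet p i \<Longrightarrow> w0 \<le> st i a \<and>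
      atom_weight ch \<phi> p st i a \<le> E * exp (- (st i a - w0) / 2)"
    and "E \<ge> 0" and l: "\<bar>l\<bar> \<le> 1 / 4"
  defines "\<mu> \<equiv> chain_law ch \<phi> p st i"
  shows "measure_pmf.expectation \<mu> (\<lambda>w. exp (l * (w - measure_pmf.expectation \<mu> (\<lambda>w. w))))
    \<le> exp (64 * E * card (alphabet p i) * l\<^sup>2)"
proof -
  define M where "M = measure_pmf.expectation \<mu> (\<lambda>w. w)"
  define \<omega> where "\<omega> = atom_weight ch \<phi> p st i"
  define u where "u a = st i a - w0" for a
  let ?A = "alphabet p i"
  let ?K = "64 * E * card ?A"
  note expct = expectation_chain_law[where p = p and i = i and ch = ch and \<phi> = \<phi> and st = st,
      OF fin, folded \<omega>_def \<mu>_def]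
  have \<omega>: "0 \<le> \<omega> a" for a by (simp add: \<omega>_def atom_weight_nonneg)
  have sum1: "sum \<omega> ?A = 1"
    using sum_atom_weight[where p = p and i = i, OF fin] by (simp add: \<omega>_def)
  have Mu: "(\<Sum>a\<in>?A. \<omega> a * u a) = M - w0"
    by (simp add: M_def expct u_def right_diff_distrib sum_subtractf sum1 flip: sum_distrib_right)
  have "(\<Sum>a\<in>?A. \<omega> a * exp (l * u a)) \<le> (\<Sum>a\<in>?A. \<omega> a + l * (\<omega> a * u a) + l\<^sup>2 * (64 * E))"
  proof (intro sum_mono)
    fix a assume a: "a \<in> ?A"
    have u: "0 \<le> u a" and w: "\<omega> a \<le> E * exp (- u a / 2)"
      using decay[OF a] by (auto simp: u_def \<omega>_def)
    have "(u a)\<^sup>2 * exp (u a / 4) * \<omega> a \<le> (u a)\<^sup>2 * exp (u a / 4) * (E * exp (- u a / 2))"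
      using w by (intro mult_left_mono) auto
    also have "\<dots> = E * ((u a)\<^sup>2 * exp (u a / 4 + - u a / 2))"
      by (simp only: exp_add mult_ac)
    also have "u a / 4 + - u a / 2 = - u a / 4" by simp
    also have "E * ((u a)\<^sup>2 * exp (- u a / 4)) \<le> E * 64"
      using quadratic_exp_le[OF u] \<open>E \<ge> 0\<close> by (intro mult_left_mono)
    finally have second: "(u a)\<^sup>2 * exp (u a / 4) * \<omega> a \<le> 64 * E" by simp
    have "\<bar>l * u a\<bar> \<le> u a / 4"
      using l u mult_right_mono[OF l u] by (simp add: abs_mult)
    then have "(l * u a)\<^sup>2 * exp \<bar>l * u a\<bar> \<le> (l * u a)\<^sup>2 * exp (u a / 4)"
      by (intro mult_left_mono) auto
    then have "\<omega> a * exp (l * u a) \<le> \<omega> a * (1 + l * u a + (l * u a)\<^sup>2 * exp (u a / 4))"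
      using exp_le_quadratic[of "l * u a"] by (intro mult_left_mono \<omega>) linarith
    also have "\<dots> = \<omega> a + l * (\<omega> a * u a) + l\<^sup>2 * ((u a)\<^sup>2 * exp (u a / 4) * \<omega> a)"
      by (simp add: algebra_simps power_mult_distrib)
    also have "\<dots> \<le> \<omega> a + l * (\<omega> a * u a) + l\<^sup>2 * (64 * E)"
      by (intro add_left_mono mult_left_mono second) simp
    finally show "\<omega> a * exp (l * u a) \<le> \<omega> a + l * (\<omega> a * u a) + l\<^sup>2 * (64 * E)" .
  qed
  also have "\<dots> = 1 + (l * (M - w0) + ?K * l\<^sup>2)"
    by (simp add: sum.distrib sum1 Mu flip: sum_distrib_left)
  also have "\<dots> \<le> exp (l * (M - w0) + ?K * l\<^sup>2)"
    by (rule exp_ge_add_one_self)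
  finally have bound: "(\<Sum>a\<in>?A. \<omega> a * exp (l * u a)) \<le> exp (l * (M - w0) + ?K * l\<^sup>2)" .
  have "measure_pmf.expectation \<mu> (\<lambda>w. exp (l * (w - M)))
      = (\<Sum>a\<in>?A. exp (- (l * (M - w0))) * (\<omega> a * exp (l * u a)))"
    unfolding expct
  proof (intro sum.cong refl)
    fix a
    have "l * (st i a - M) = - (l * (M - w0)) + l * u a"
      by (simp add: u_def algebra_simps)
    then show "\<omega> a * exp (l * (st i a - M)) = exp (- (l * (M - w0))) * (\<omega> a * exp (l * u a))"
      by (simp only: exp_add mult_ac)
  qed
  also have "\<dots> = exp (- (l * (M - w0))) * (\<Sum>a\<in>?A. \<omega> a * exp (l * u a))"
    by (simp only: sum_distrib_left)
  also have "\<dots> \<le> exp (- (l * (M - w0))) * exp (l * (M - w0) + ?K * l\<^sup>2)"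
    using bound by (intro mult_left_mono) auto
  also have "\<dots> = exp (?K * l\<^sup>2)"
    by (simp only: exp_add[symmetric]) simp
  finally show ?thesis by (simp add: M_def)
qed

lemma block_law_mgf_le:
  assumes fin: "finite I" "\<And>i. i \<in> I \<Longrightarrow> finite (set_pmf (\<mu> i))"
    and mgf: "\<And>i. i \<in> I \<Longrightarrow> measure_pmf.expectation (\<mu> i)
      (\<lambda>w. exp (l * (w - measure_pmf.expectation (\<mu> i) (\<lambda>w. w)))) \<le> exp (\<kappa> i)"
  shows "measure_pmf.expectation (block_law \<mu> I) (\<lambda>w. exp (l * (w - block_mean \<mu> I))) \<le> exp (sum \<kappa> I)"
proof -
  let ?M = "\<lambda>i. measure_pmf.expectation (\<mu> i) (\<lambda>w. w)"
  have "measure_pmf.expectation (block_law \<mu> I) (\<lambda>w. exp (l * (w - block_mean \<mu> I)))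
    = measure_pmf.expectation (Pi_pmf I 0 \<mu>) (\<lambda>x. \<Prod>i\<in>I. exp (l * (x i - ?M i)))"
    unfolding block_law_def integral_map_pmf block_mean_def sum_subtractf[symmetric] sum_distrib_left
    by (simp only: exp_sum[OF fin(1)])
  also have "\<dots> = (\<Prod>i\<in>I. measure_pmf.expectation (\<mu> i) (\<lambda>w. exp (l * (w - ?M i))))"
    using fin by (intro expectation_prod_Pi_pmf integrable_measure_pmf_finite) auto
  also have "\<dots> \<le> (\<Prod>i\<in>I. exp (\<kappa> i))"
    using mgf by (intro prod_mono conjI integral_nonneg) auto
  also have "\<dots> = exp (sum \<kappa> I)" by (simp only: exp_sum[OF fin(1)])
  finally show ?thesis .
qed

lemma block_law_tail_le:
  assumes fin: "finite (set_pmf \<nu>)" and l: "l > 0"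
    and mgf: "\<And>s. s \<in> {l, -l} \<Longrightarrow> measure_pmf.expectation \<nu> (\<lambda>w. exp (s * (w - c))) \<le> X"
  shows "measure_pmf.prob \<nu> {w. \<not> \<bar>w - c\<bar> \<le> h} \<le> 2 * X * exp (- (l * h))"
proof -
  have tail: "measure_pmf.prob \<nu> {w. exp (s * (w - c)) \<ge> exp (l * h)} \<le> X * exp (- (l * h))"
    if s: "s \<in> {l, -l}" for s
  proof -
    have "measure_pmf.prob \<nu> {w. exp (s * (w - c)) \<ge> exp (l * h)}
      \<le> measure_pmf.expectation \<nu> (\<lambda>w. exp (s * (w - c))) / exp (l * h)"
      using integral_Markov_inequality_measure[of \<nu> "\<lambda>w. exp (s * (w - c))" "{}" "exp (l * h)"] fin
      by (simp add: integrable_measure_pmf_finite)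
    also have "\<dots> \<le> X / exp (l * h)" using mgf[OF s] by (intro divide_right_mono) auto
    finally show ?thesis by (simp add: exp_minus field_simps)
  qed
  have "{w. \<not> \<bar>w - c\<bar> \<le> h} \<subseteq> {w. exp (l * (w - c)) \<ge> exp (l * h)} \<union> {w. exp (- l * (w - c)) \<ge> exp (l * h)}"
  proof
    fix w assume "w \<in> {w. \<not> \<bar>w - c\<bar> \<le> h}"
    then have "h \<le> w - c \<or> h \<le> - (w - c)" by auto
    then have "l * h \<le> l * (w - c) \<or> l * h \<le> l * - (w - c)"
      using l by (meson mult_left_mono less_imp_le)
    then show "w \<in> {w. exp (l * (w - c)) \<ge> exp (l * h)} \<union> {w. exp (- l * (w - c)) \<ge> exp (l * h)}"
      by (simp add: algebra_simps)
  qed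
  then have "measure_pmf.prob \<nu> {w. \<not> \<bar>w - c\<bar> \<le> h} \<le> measure_pmf.prob \<nu>
    ({w. exp (l * (w - c)) \<ge> exp (l * h)} \<union> {w. exp (- l * (w - c)) \<ge> exp (l * h)})"
    by (intro measure_pmf.finite_measure_mono) auto
  also have "\<dots> \<le> measure_pmf.prob \<nu> {w. exp (l * (w - c)) \<ge> exp (l * h)}
    + measure_pmf.prob \<nu> {w. exp (- l * (w - c)) \<ge> exp (l * h)}"
    by (rule measure_Un_le) auto
  also have "\<dots> \<le> X * exp (- (l * h)) + X * exp (- (l * h))"
    by (intro add_mono tail) auto
  finally show ?thesis by simp
qed

lemma half_decaying_atom_weight:
  assumes "setting m \<eta> p st" "\<eta> \<le> \<eta>\<^sub>0" "half_decaying m \<eta> ch \<phi> p st" "i < m" "a \<in> alphabet p i"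
  shows "Min (st i ` alphabet p i) \<le> st i a \<and>
    atom_weight ch \<phi> p st i a \<le> exp \<eta>\<^sub>0 * exp (- (st i a - Min (st i ` alphabet p i)) / 2)"
proof -
  have fin: "finite (alphabet p i)" using assms by (simp add: setting_def)
  let ?u = "st i a - Min (st i ` alphabet p i)"
  have u: "?u \<ge> 0" using fin assms(5) by simp
  obtain \<gamma> where \<gamma>: "\<gamma> \<ge> 1 / 2" "\<And>a\<^sub>0. a\<^sub>0 \<in> alphabet p i \<Longrightarrow>
      (\<forall>a'\<in>alphabet p i. surprisal p i a\<^sub>0 \<le> surprisal p i a') \<Longrightarrow>
      atom_weight ch \<phi> p st i a \<le> exp \<eta> * exp (- \<gamma> * ?u) * atom_weight ch \<phi> p st i a\<^sub>0"
    using assms unfolding half_decaying_def by blast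
  have "Min (surprisal p i ` alphabet p i) \<in> surprisal p i ` alphabet p i"
    using fin set_pmf_not_empty by (intro Min_in) auto
  then obtain a\<^sub>0 where a0: "a\<^sub>0 \<in> alphabet p i" "surprisal p i a\<^sub>0 = Min (surprisal p i ` alphabet p i)"
    by auto
  have "atom_weight ch \<phi> p st i a \<le> exp \<eta> * exp (- \<gamma> * ?u) * atom_weight ch \<phi> p st i a\<^sub>0"
    using fin a0 by (intro \<gamma>(2)) auto
  also have "\<dots> \<le> exp \<eta>\<^sub>0 * exp (- ?u / 2) * 1"
  proof (intro mult_mono)
    show "exp (- \<gamma> * ?u) \<le> exp (- ?u / 2)"
      using mult_right_mono[OF \<gamma>(1) u] by simp
    show "atom_weight ch \<phi> p st i a\<^sub>0 \<le> 1" by (rule atom_weight_le_1[where p = p and i = i, OF fin a0(1)])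
  qed (use assms in \<open>auto simp: atom_weight_nonneg\<close>)
  finally show ?thesis using u by simp
qed

lemma card_le_block_size:
  assumes "setting m \<eta> p st" "I \<subseteq> {..<m}"
  shows "card I \<le> block_size p I"
proof -
  have "(\<Sum>i\<in>I. 1) \<le> block_size p I"
    unfolding block_size_def
  proof (rule sum_mono)
    fix i assume "i \<in> I"
    then have "finite (alphabet p i)" using assms by (auto simp: setting_def)
    then show "1 \<le> card (alphabet p i)"
      by (simp add: Suc_le_eq card_gt_0_iff set_pmf_not_empty)
  qed
  then show ?thesis by simp
qed

lemma block_size_ge_1:
  assumes "setting m \<eta> p st" "I \<subseteq> {..<m}" "I \<noteq> {}"
  shows "1 \<le> real (block_size p I)"
proof -
  have "card I \<ge> 1" using assms finite_subset by (auto simp: Suc_le_eq card_gt_0_iff)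
  then show ?thesis using card_le_block_size[OF assms(1,2)] by linarith
qed

lemma half_decaying_tail:
  assumes set: "setting m \<eta> p st" "\<eta> \<le> \<eta>\<^sub>0" "half_decaying m \<eta> ch \<phi> p st"
    and I: "I \<subseteq> {..<m}" "I \<noteq> {}"
  defines "\<mu> \<equiv> chain_law ch \<phi> p st"
  shows "measure_pmf.prob (block_law \<mu> I) {w. \<not> \<bar>w - block_mean \<mu> I\<bar> \<le> h}
    \<le> 2 * exp (4 * exp \<eta>\<^sub>0) * exp (- (h / (4 * sqrt (block_size p I))))"
proof -
  let ?B = "real (block_size p I)"
  have finI: "finite I" using I finite_subset by blast
  have fin: "finite (alphabet p i)" if "i \<in> I" for i
    using set(1) I that by (auto simp: setting_def)
  have B: "?B \<ge> 1" by (rule block_size_ge_1[OF set(1) I])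
  define l where "l = 1 / (4 * sqrt ?B)"
  have l: "0 < l" "l \<le> 1 / 4" using B by (auto simp: l_def)
  have l2: "l\<^sup>2 * ?B = 1 / 16" using B by (simp add: l_def power_divide power_mult_distrib)
  have finS: "finite (set_pmf (\<mu> i))" if "i \<in> I" for i
    using fin[OF that] by (simp add: \<mu>_def set_pmf_chain_law)
  have "measure_pmf.expectation (block_law \<mu> I) (\<lambda>w. exp (s * (w - block_mean \<mu> I))) \<le> exp (4 * exp \<eta>\<^sub>0)"
    if s: "s \<in> {l, -l}" for s
  proof -
    have "measure_pmf.expectation (block_law \<mu> I) (\<lambda>w. exp (s * (w - block_mean \<mu> I)))
      \<le> exp (\<Sum>i\<in>I. 64 * exp \<eta>\<^sub>0 * card (alphabet p i) * s\<^sup>2)"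
    proof (rule block_law_mgf_le[OF finI finS])
      fix i assume i: "i \<in> I"
      then have im: "i < m" using I by auto
      show "measure_pmf.expectation (\<mu> i) (\<lambda>w. exp (s * (w - measure_pmf.expectation (\<mu> i) (\<lambda>w. w))))
        \<le> exp (64 * exp \<eta>\<^sub>0 * card (alphabet p i) * s\<^sup>2)"
        unfolding \<mu>_def using s l
        by (intro chain_law_mgf_le[where ?w0.0 = "Min (st i ` alphabet p i)"] fin[OF i]
            half_decaying_atom_weight[OF set im]) auto
    qed
    also have "(\<Sum>i\<in>I. 64 * exp \<eta>\<^sub>0 * card (alphabet p i) * s\<^sup>2) = 64 * exp \<eta>\<^sub>0 * (l\<^sup>2 * ?B)"
      using s by (auto simp: block_size_def sum_distrib_left sum_distrib_right mult_ac)
    also have "\<dots> = 4 * exp \<eta>\<^sub>0" unfolding l2 by simp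
    finally show ?thesis .
  qed
  moreover have "finite (set_pmf (block_law \<mu> I))"
  proof -
    have "grid_supported \<eta> (block_law \<mu> I)"
      using I finI grid_supported_chain_law[OF set(1)] unfolding \<mu>_def
      by (intro grid_supported_block_law) auto
    then show ?thesis by (simp add: grid_supported_def)
  qed
  ultimately have "measure_pmf.prob (block_law \<mu> I) {w. \<not> \<bar>w - block_mean \<mu> I\<bar> \<le> h}
    \<le> 2 * exp (4 * exp \<eta>\<^sub>0) * exp (- (l * h))"
    using l by (intro block_law_tail_le) auto
  then show ?thesis by (simp add: l_def)
qed

lemma poly_growth:
  fixes q :: "real poly"
  shows "\<exists>C\<ge>0. \<exists>d. \<forall>y z. \<bar>y\<bar> \<le> z \<and> 1 \<le> z \<longrightarrow> \<bar>poly q y\<bar> \<le> C * z ^ d"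
proof (induction q rule: pCons_induct)
  case 0
  show ?case by (intro exI[of _ 0]) simp
next
  case (pCons a q)
  then obtain C d where C: "C \<ge> 0" "\<And>y z. \<bar>y\<bar> \<le> z \<Longrightarrow> 1 \<le> z \<Longrightarrow> \<bar>poly q y\<bar> \<le> C * z ^ d"
    by blast
  have "\<bar>poly (pCons a q) y\<bar> \<le> (\<bar>a\<bar> + C) * z ^ Suc d" if yz: "\<bar>y\<bar> \<le> z" "1 \<le> z" for y z
  proof -
    have "\<bar>poly (pCons a q) y\<bar> \<le> \<bar>a\<bar> + \<bar>y\<bar> * \<bar>poly q y\<bar>"
      by (simp add: abs_mult[symmetric] abs_triangle_ineq)
    also have "\<dots> \<le> \<bar>a\<bar> * z ^ Suc d + z * (C * z ^ d)"
    proof (intro add_mono mult_mono)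
      show "\<bar>a\<bar> \<le> \<bar>a\<bar> * z ^ Suc d"
        using one_le_power[OF yz(2), of "Suc d"] mult_left_mono[of 1 "z ^ Suc d" "\<bar>a\<bar>"] by simp
    qed (use yz C in auto)
    also have "\<dots> = (\<bar>a\<bar> + C) * z ^ Suc d" by (simp add: algebra_simps)
    finally show ?thesis .
  qed
  then show ?case using C(1) by (intro exI[of _ "\<bar>a\<bar> + C"] conjI exI[of _ "Suc d"]) auto
qed

lemma poly2_growth:
  "\<exists>C\<ge>0. \<exists>d. \<forall>x y z. \<bar>x\<bar> \<le> z \<and> \<bar>y\<bar> \<le> z \<and> 1 \<le> z \<longrightarrow> \<bar>poly2 P x y\<bar> \<le> C * z ^ d"
proof (induction P rule: pCons_induct)
  case 0
  show ?case by (intro exI[of _ 0]) (simp add: poly2_def)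
next
  case (pCons q P)
  then obtain C d where C: "C \<ge> 0"
    "\<And>x y z. \<bar>x\<bar> \<le> z \<Longrightarrow> \<bar>y\<bar> \<le> z \<Longrightarrow> 1 \<le> z \<Longrightarrow> \<bar>poly2 P x y\<bar> \<le> C * z ^ d"
    by blast
  obtain C' d' where C': "C' \<ge> 0" "\<And>y z. \<bar>y\<bar> \<le> z \<Longrightarrow> 1 \<le> z \<Longrightarrow> \<bar>poly q y\<bar> \<le> C' * z ^ d'"
    using poly_growth[of q] by blast
  have "\<bar>poly2 (pCons q P) x y\<bar> \<le> (C' + C) * z ^ (d' + Suc d)"
    if z: "\<bar>x\<bar> \<le> z" "\<bar>y\<bar> \<le> z" "1 \<le> z" for x y z
  proof -
    have "poly2 (pCons q P) x y = poly q y + x * poly2 P x y"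
      by (simp add: poly2_def)
    then have "\<bar>poly2 (pCons q P) x y\<bar> \<le> \<bar>poly q y\<bar> + \<bar>x\<bar> * \<bar>poly2 P x y\<bar>"
      by (simp add: abs_mult[symmetric] abs_triangle_ineq)
    also have "\<dots> \<le> C' * z ^ d' + z * (C * z ^ d)"
      using z C C' by (intro add_mono mult_mono) auto
    also have "\<dots> = C' * z ^ d' + C * z ^ Suc d" by simp
    also have "\<dots> \<le> C' * z ^ (d' + Suc d) + C * z ^ (d' + Suc d)"
      using z C(1) C'(1) by (intro add_mono mult_left_mono power_increasing) auto
    also have "\<dots> = (C' + C) * z ^ (d' + Suc d)" by (simp only: distrib_right)
    finally show ?thesis .
  qed
  then show ?case using C(1) C'(1) by (intro exI[of _ "C' + C"] conjI exI[of _ "d' + Suc d"]) auto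
qed

section \<open>Cost bounds\<close>

lemma log2_le: "log 2 x \<le> 2 * ln y" if "0 < x" "x \<le> y" "1 \<le> y" for x y :: real
proof -
  have "log 2 x \<le> log 2 y" using that by simp
  also have "\<dots> = ln y / ln 2" by (simp add: log_def)
  also have "\<dots> \<le> ln y / (1 / 2)"
    using that ln2_ge_two_thirds by (intro divide_left_mono) auto
  finally show ?thesis by simp
qed

lemma ln_2_plus_ge_1: "1 \<le> ln (2 + x)" if "1 \<le> x" for x :: real
proof -
  have "exp 1 \<le> 2 + x" using exp_le that by linarith
  then show ?thesis using that by (simp add: ln_ge_iff)
qed

lemma depth_balanced:
  assumes "balanced_tree m t" "m \<ge> 1"
  shows "real (depth t) \<le> log 2 m + 1"
proof -
  have "real (depth t) = of_int \<lceil>log 2 m\<rceil>"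
    using assms(1) unfolding balanced_tree_def by (metis of_int_of_nat_eq)
  then show ?thesis by linarith
qed

lemma sum_list_coords:
  assumes "balanced_tree m t"
  shows "(\<Sum>i\<leftarrow>coords t. f i) = (\<Sum>i<m. f i)"
  using assms by (simp add: balanced_tree_def sum_list_distinct_conv_sum_set)

lemma surprisal_range_nonneg: "setting m \<eta> p st \<Longrightarrow> 0 \<le> surprisal_range p m"
  unfolding surprisal_range_def by (intro sum_nonneg) (auto dest: len_histogram_chain_law(3))

lemma words_histogram_sum:
  fixes ch :: chain and \<phi> :: real
  assumes "setting m \<eta> p st"
  defines "W \<equiv> \<Sum>i<m. words (histogram \<eta> (chain_law ch \<phi> p st i))"
  shows "surprisal_range p m / \<eta> + m \<le> real W" "real W \<le> surprisal_range p m / \<eta> + 3 * m"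
proof -
  let ?\<rho> = "\<lambda>i. Max (surprisal p i ` alphabet p i) - Min (surprisal p i ` alphabet p i)"
  let ?n = "\<lambda>i. real (words (histogram \<eta> (chain_law ch \<phi> p st i)))"
  have W: "real W = (\<Sum>i<m. ?n i)" by (simp add: W_def)
  have R: "surprisal_range p m / \<eta> = (\<Sum>i<m. ?\<rho> i / \<eta>)"
    by (simp add: surprisal_range_def sum_divide_distrib)
  have "(\<Sum>i<m. ?\<rho> i / \<eta> + 1) \<le> (\<Sum>i<m. ?n i)"
    using len_histogram_chain_law(1)[OF assms(1)] by (intro sum_mono) simp
  then show "surprisal_range p m / \<eta> + m \<le> real W" by (simp add: R W sum.distrib)
  have "(\<Sum>i<m. ?n i) \<le> (\<Sum>i<m. ?\<rho> i / \<eta> + 3)"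
    proof (intro sum_mono)
    fix i assume "i \<in> {..<m}"
    then show "?n i \<le> ?\<rho> i / \<eta> + 3"
      using len_histogram_chain_law(2)[OF assms(1), of i ch \<phi>] by simp
  qed
  then show "real W \<le> surprisal_range p m / \<eta> + 3 * m" by (simp add: R W sum.distrib)
qed

lemma full_space_bounds:
  fixes ch :: chain and \<phi> :: real
  assumes set: "setting m \<eta> p st" and t: "balanced_tree m t"
  defines "S \<equiv> real (full_space (\<lambda>i. histogram \<eta> (chain_law ch \<phi> p st i)) t)"
  shows "surprisal_range p m / \<eta> + m \<le> S" "S \<le> 129 * (surprisal_range p m / \<eta> + m)"
proof -
  let ?H = "\<lambda>i. histogram \<eta> (chain_law ch \<phi> p st i)"
  let ?W = "\<Sum>i<m. words (?H i)"
  note W = words_histogram_sum[where ch = ch and \<phi> = \<phi>, OF set]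
  have \<eta>: "\<eta> > 0" using set by (simp add: setting_def)
  have ge: "?W \<le> S_merge (\<lambda>i. words (?H i)) ?H no_crop t"
    using S_merge_resident_ge[of ?H t] by (simp only: sum_list_coords[OF t])
  have le: "S_merge (\<lambda>i. words (?H i)) ?H no_crop t \<le> 43 * ?W" "words (merge ?H no_crop t) \<le> ?W"
    using S_merge_resident_le[of ?H t] by (simp_all only: sum_list_coords[OF t])
  have "2 * words (merge ?H no_crop t) \<le> 43 * ?W"
    using le(2) by (intro mult_le_mono) simp_all
  then have "?W \<le> full_space ?H t" "full_space ?H t \<le> 43 * ?W"
    unfolding full_space_def using max.coboundedI1[OF ge] max.boundedI[OF le(1)] by blast+
  then have "real ?W \<le> S" "S \<le> real (43 * ?W)"
    unfolding S_def by (blast intro: of_nat_mono)+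
  then have S: "real ?W \<le> S" "S \<le> 43 * real ?W"
    by (simp_all only: of_nat_mult of_nat_numeral)
  show "surprisal_range p m / \<eta> + m \<le> S" using W(1) S(1) by linarith
  have "0 \<le> surprisal_range p m / \<eta>" using surprisal_range_nonneg[OF set] \<eta> by simp
  then show "S \<le> 129 * (surprisal_range p m / \<eta> + m)" using W(2) S(2) by (simp add: distrib_left)
qed

lemma full_time_le:
  assumes set: "setting m \<eta> p st" and t: "balanced_tree m t"
  defines "X \<equiv> surprisal_range p m / \<eta> + block_size p {..<m}"
  shows "real (full_time (\<lambda>i. card (alphabet p i)) (\<lambda>i. histogram \<eta> (chain_law ch \<phi> p st i)) t)
    \<le> 2200 * X * polylog 2 X"
proof -
  let ?H = "\<lambda>i. histogram \<eta> (chain_law ch \<phi> p st i)"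
  let ?Y = "\<lambda>t. \<Sum>i\<leftarrow>coords t. real (words (?H i))"
  define L where "L = ln (2 + X)"
  note W = words_histogram_sum[where ch = ch and \<phi> = \<phi>, OF set]
  have \<eta>: "\<eta> > 0" and m: "m \<ge> 1" using set by (simp_all add: setting_def)
  have Yt: "?Y t = real (\<Sum>i<m. words (?H i))"
    by (simp only: sum_list_coords[OF t] of_nat_sum)
  have R: "0 \<le> surprisal_range p m / \<eta>" using surprisal_range_nonneg[OF set] \<eta> by simp
  have mB: "real m \<le> block_size p {..<m}" using card_le_block_size[OF set order_refl] by simp
  have X: "1 \<le> X" "real m \<le> X" using R mB m unfolding X_def by linarith+
  have "?Y t \<le> surprisal_range p m / \<eta> + 3 * real m" "surprisal_range p m / \<eta> + real m \<le> ?Y t"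
    using W unfolding Yt by simp_all
  then have Y: "?Y t \<le> 3 * X" "1 \<le> ?Y t"
    using R mB m unfolding X_def distrib_left by linarith+
  have L: "1 \<le> L" unfolding L_def using X by (intro ln_2_plus_ge_1)
  have logX: "log 2 X \<le> 2 * L" unfolding L_def using X by (intro log2_le) auto
  have "log 2 (?Y t) \<le> log 2 (4 * X)" using Y X by (subst log_le_cancel_iff) auto
  also have "\<dots> = 2 + log 2 X" using X log_pow_cancel[of 2 2] by (simp add: log_mult)
  also have "\<dots> \<le> 4 * L" using logX L by simp
  finally have logY: "2 + log 2 (?Y t) \<le> 6 * L" using L by linarith
  have "log 2 m \<le> 2 * L" unfolding L_def using X m by (intro log2_le) auto
  then have d: "real (depth t) + 1 \<le> 4 * L"
    using depth_balanced[OF t m] L by linarith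
  have "real (T_merge ?H no_crop t) \<le> 20 * (real (depth t) + 1) * (2 + log 2 (?Y t)) * ?Y t"
  proof (rule T_merge_le)
    fix s
    have "real (words (merge ?H no_crop s)) \<le> real (\<Sum>i\<leftarrow>coords s. words (?H i))"
      using S_merge_resident_le(2)[of ?H s] of_nat_le_iff by blast
    also have "\<dots> = ?Y s" by (induction s) auto
    finally show "real (len (merge ?H no_crop s)) + 1 \<le> ?Y s" by simp
  qed simp
  also have "\<dots> \<le> 20 * (4 * L) * (6 * L) * (3 * X)"
    using d logY Y L by (intro mult_mono mult_nonneg_nonneg) auto
  finally have T: "real (T_merge ?H no_crop t) \<le> 1440 * (L\<^sup>2 * X)"
    by (simp add: power2_eq_square)
  have "words (merge ?H no_crop t) \<le> (\<Sum>i<m. words (?H i))"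
    using S_merge_resident_le(2)[of ?H t] by (simp only: sum_list_coords[OF t])
  then have root: "real (len (merge ?H no_crop t)) \<le> ?Y t" unfolding Yt by linarith
  have "(\<Sum>i\<leftarrow>coords t. card (alphabet p i) + len (?H i)) = block_size p {..<m} + (\<Sum>i<m. len (?H i))"
    unfolding sum_list_coords[OF t] block_size_def by (simp add: sum.distrib)
  moreover have "(\<Sum>i<m. len (?H i)) \<le> (\<Sum>i<m. words (?H i))" by (intro sum_mono) simp
  ultimately have "real (\<Sum>i\<leftarrow>coords t. card (alphabet p i) + len (?H i)) \<le> X + ?Y t"
    using R unfolding Yt X_def by linarith
  then have "real (full_time (\<lambda>i. card (alphabet p i)) ?H t) \<le> 7 * X + 1440 * (L\<^sup>2 * X)"
    using T root Y unfolding full_time_def of_nat_add by linarith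
  also have "7 * X \<le> 7 * (L\<^sup>2 * X)"
    using L X one_le_power[OF L, of 2] mult_right_mono[of 1 "L\<^sup>2" X] by simp
  finally show ?thesis using X by (simp add: polylog_def L_def mult_ac)
qed

lemma tail_exponent:
  assumes "\<eta>\<^sub>0 > 0"
    and pos: "\<And>(m::nat) \<eta>. m \<ge> 1 \<Longrightarrow> 0 < \<eta> \<Longrightarrow> \<eta> \<le> \<eta>\<^sub>0 \<Longrightarrow> poly2 P m (1 / \<eta>) > 0"
  obtains n :: nat where "\<And>(m::nat) \<eta>. m \<ge> 1 \<Longrightarrow> 0 < \<eta> \<Longrightarrow> \<eta> \<le> \<eta>\<^sub>0 \<Longrightarrow>
    2 * exp (4 * exp \<eta>\<^sub>0) * exp (- (n * ln (2 + (m + 1 / \<eta>)))) \<le> 1 / (2 * m * poly2 P m (1 / \<eta>))"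
proof -
  obtain C d where C: "C \<ge> 0"
    "\<And>x y z. \<bar>x\<bar> \<le> z \<Longrightarrow> \<bar>y\<bar> \<le> z \<Longrightarrow> 1 \<le> z \<Longrightarrow> \<bar>poly2 P x y\<bar> \<le> C * z ^ d"
    using poly2_growth[of P] by blast
  define E where "E = exp (4 * exp \<eta>\<^sub>0)"
  obtain q where q: "4 * E * C < 2 ^ q"
    using real_arch_pow[of 2 "4 * E * C"] by auto
  define n where "n = q + Suc d"
  have "2 * E * exp (- (n * ln (2 + (m + 1 / \<eta>)))) \<le> 1 / (2 * m * poly2 P m (1 / \<eta>))"
    if m: "m \<ge> 1" and \<eta>: "0 < \<eta>" "\<eta> \<le> \<eta>\<^sub>0" for m :: nat and \<eta>
  proof -
    define z where "z = 2 + (m + 1 / \<eta>)"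
    let ?P = "poly2 P m (1 / \<eta>)"
    have z: "2 \<le> z" "real m \<le> z" "1 / \<eta> \<le> z" using \<eta> by (auto simp: z_def)
    have P: "0 < ?P" using pos m \<eta> by blast
    have "?P \<le> C * z ^ d" using C(2)[of m z "1 / \<eta>"] z \<eta> by force
    then have "4 * E * (m * ?P) \<le> 4 * E * (z * (C * z ^ d))"
      using z P by (intro mult_left_mono mult_mono) (auto simp: E_def)
    also have "\<dots> = (4 * E * C) * z ^ Suc d" by simp
    also have "\<dots> \<le> z ^ q * z ^ Suc d"
      using q z power_mono[of 2 z q] by (intro mult_right_mono) auto
    also have "\<dots> = z ^ n" by (simp add: n_def power_add)
    finally have le: "4 * E * (m * ?P) \<le> z ^ n" .
    have "exp (- (n * ln z)) = 1 / z ^ n"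
      using z by (simp add: exp_minus exp_of_nat_mult inverse_eq_divide)
    then have "2 * E * exp (- (n * ln z)) = 2 * E / z ^ n" by simp
    also have "\<dots> \<le> 1 / (2 * m * ?P)"
      using le z P m by (simp add: divide_simps mult_ac)
    finally show ?thesis by (simp add: z_def)
  qed
  then show thesis using that[of n] by (simp add: n_def E_def)
qed

abbreviation mean_window :: "nat \<Rightarrow> nat \<Rightarrow> real \<Rightarrow> (nat \<Rightarrow> 'a pmf) \<Rightarrow> (nat \<Rightarrow> real pmf) \<Rightarrow> nat set \<Rightarrow> grid_array \<Rightarrow> grid_array" where
  "mean_window n m \<eta> p \<mu> \<equiv> (\<lambda>I. window \<eta> (block_mean \<mu> I) (half_width (4 * real n) 1 m \<eta> p I))"

lemma block_size_le_sum_list: "block_size p (set xs) \<le> (\<Sum>i\<leftarrow>xs. card (alphabet p i))"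
  unfolding block_size_def by (induction xs) (auto simp: sum.insert_if)

lemma half_width_eq:
  "half_width (4 * real n) 1 m \<eta> p I = 4 * real n * sqrt (block_size p I) * ln (2 + (m + 1 / \<eta>))"
  by (simp add: half_width_def polylog_def)

lemma words_crop_le:
  fixes m :: nat
  assumes "\<eta> > 0"
  shows "real (words (merge H (mean_window n m \<eta> p \<mu>) s))
    \<le> 8 * real n * ln (2 + (m + 1 / \<eta>)) / \<eta> * sqrt (\<Sum>i\<leftarrow>coords s. real (card (alphabet p i))) + 2"
proof -
  let ?h = "half_width (4 * real n) 1 m \<eta> p (set (coords s))"
  let ?L = "ln (2 + (m + 1 / \<eta>))"
  have L: "0 \<le> ?L" using assms by simp
  have h: "0 \<le> ?h" using L unfolding half_width_eq by (intro mult_nonneg_nonneg) auto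
  have "real (block_size p (set (coords s))) \<le> real (\<Sum>i\<leftarrow>coords s. card (alphabet p i))"
    using block_size_le_sum_list of_nat_le_iff by blast
  also have "\<dots> = (\<Sum>i\<leftarrow>coords s. real (card (alphabet p i)))"
    by (induction s) auto
  finally have B: "sqrt (block_size p (set (coords s))) \<le> sqrt (\<Sum>i\<leftarrow>coords s. real (card (alphabet p i)))"
    by simp
  obtain A where "merge H (mean_window n m \<eta> p \<mu>) s = window \<eta> (block_mean \<mu> (set (coords s))) ?h A"
    by (cases s) auto
  then have "real (words (merge H (mean_window n m \<eta> p \<mu>) s)) \<le> 2 * ?h / \<eta> + 2"
    using len_window_le[OF assms h, of "block_mean \<mu> (set (coords s))" A] by simp
  also have "2 * ?h / \<eta> = 8 * real n * ?L / \<eta> * sqrt (block_size p (set (coords s)))"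
    unfolding half_width_eq by simp
  also have "\<dots> \<le> 8 * real n * ?L / \<eta> * sqrt (\<Sum>i\<leftarrow>coords s. real (card (alphabet p i)))"
    using B L assms by (intro mult_left_mono) auto
  finally show ?thesis by simp
qed

lemma sqrt_mult_superadd:
  fixes a b c d :: real
  assumes "0 \<le> a" "0 \<le> b" "0 \<le> c" "0 \<le> d"
  shows "sqrt (a * b) + sqrt (c * d) \<le> sqrt ((a + c) * (b + d))"
proof (rule real_le_rsqrt)
  have "2 * (sqrt (a * d) * sqrt (c * b)) \<le> a * d + c * b"
    using sum_squares_bound[of "sqrt (a * d)" "sqrt (c * b)"] assms by simp
  moreover have "sqrt (a * b) * sqrt (c * d) = sqrt (a * d) * sqrt (c * b)"
    by (simp add: mult_ac flip: real_sqrt_mult)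
  ultimately show "(sqrt (a * b) + sqrt (c * d))\<^sup>2 \<le> (a + c) * (b + d)"
    using assms by (simp add: power2_sum algebra_simps)
qed

lemma sum_list_nonneg_real: "0 \<le> (\<Sum>i\<leftarrow>xs. real (f i))"
  by (induction xs) auto

definition cost_const :: "real \<Rightarrow> nat \<Rightarrow> real" where
  "cost_const \<eta>\<^sub>0 n = 84 * (8 + log 2 (8 * real n + 2)) * (8 * real n + 2 * \<eta>\<^sub>0)"

lemma cost_const_ge:
  assumes "\<eta>\<^sub>0 > 0"
  shows "336 * (8 * real n + 2 * \<eta>\<^sub>0) \<le> cost_const \<eta>\<^sub>0 n" "8 * real n + \<eta>\<^sub>0 \<le> cost_const \<eta>\<^sub>0 n"
    "0 \<le> cost_const \<eta>\<^sub>0 n"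
proof -
  have "0 \<le> log 2 (8 * real n + 2)" by simp
  then show *: "336 * (8 * real n + 2 * \<eta>\<^sub>0) \<le> cost_const \<eta>\<^sub>0 n"
    unfolding cost_const_def using assms by (intro mult_right_mono) auto
  then show "8 * real n + \<eta>\<^sub>0 \<le> cost_const \<eta>\<^sub>0 n" "0 \<le> cost_const \<eta>\<^sub>0 n"
    using assms by auto
qed

context
  fixes m :: nat and \<eta> \<eta>\<^sub>0 :: real and p :: "nat \<Rightarrow> 'a pmf" and st and n :: nat and t :: mtree
  assumes set: "setting m \<eta> p st" and \<eta>\<^sub>0: "\<eta> \<le> \<eta>\<^sub>0" and t: "balanced_tree m t"
begin

private definition "B = real (block_size p {..<m})"
private definition "L = ln (2 + (B + 1 / \<eta>))"

private lemma facts: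
  "0 < \<eta>" "1 \<le> m" "1 \<le> B" "real m \<le> B" "1 \<le> L" "ln (2 + (m + 1 / \<eta>)) \<le> L" "0 \<le> ln (2 + (m + 1 / \<eta>))"
  "real (depth t) + 1 \<le> 4 * L" "(\<Sum>i\<leftarrow>coords t. real (card (alphabet p i))) = B"
proof -
  show \<eta>: "0 < \<eta>" and m: "1 \<le> m" using set by (simp_all add: setting_def)
  show mB: "real m \<le> B" using card_le_block_size[OF set order_refl] by (simp add: B_def)
  then show B: "1 \<le> B" using m by linarith
  show L: "1 \<le> L" unfolding L_def using B \<eta> by (intro ln_2_plus_ge_1) (simp add: add_increasing2)
  show "ln (2 + (m + 1 / \<eta>)) \<le> L"
    unfolding L_def using mB \<eta> by (subst ln_le_cancel_iff) (auto simp: add_pos_nonneg)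
  show "0 \<le> ln (2 + (m + 1 / \<eta>))" using \<eta> by simp
  have "0 < 1 / \<eta>" using \<eta> by simp
  then have "log 2 m \<le> 2 * L"
    unfolding L_def using mB m B by (intro log2_le) linarith+
  then show "real (depth t) + 1 \<le> 4 * L" using depth_balanced[OF t m] L by linarith
  show "(\<Sum>i\<leftarrow>coords t. real (card (alphabet p i))) = B"
    by (simp add: sum_list_coords[OF t] B_def block_size_def)
qed

lemma truncated_space_le:
  "real (truncated_space H (mean_window n m \<eta> p \<mu>) t)
    \<le> cost_const \<eta>\<^sub>0 n * (sqrt (block_size p {..<m}) / \<eta>) * polylog 3 (block_size p {..<m} + 1 / \<eta>)"
proof -
  let ?L = "ln (2 + (m + 1 / \<eta>))"
  let ?\<alpha> = "8 * real n * ?L / \<eta>"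
  let ?b = "\<lambda>s. \<Sum>i\<leftarrow>coords s. real (card (alphabet p i))"
  let ?Y = "\<lambda>s. ?\<alpha> * sqrt (?b s) + 2"
  have \<alpha>: "0 \<le> ?\<alpha>" using facts by simp
  have mono: "?Y l \<le> ?Y (Join l r)" "?Y r \<le> ?Y (Join l r)" for l r
  proof -
    have "?\<alpha> * sqrt (?b l) \<le> ?\<alpha> * sqrt (?b l + ?b r)" "?\<alpha> * sqrt (?b r) \<le> ?\<alpha> * sqrt (?b l + ?b r)"
      using \<alpha> sum_list_nonneg_real[of _ "coords l"] sum_list_nonneg_real[of _ "coords r"]
      by (intro mult_left_mono; simp)+
    then show "?Y l \<le> ?Y (Join l r)" "?Y r \<le> ?Y (Join l r)" by simp_all
  qed
  have words: "real (words (merge H (mean_window n m \<eta> p \<mu>) s)) \<le> ?Y s" for s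
    by (rule words_crop_le[OF facts(1)])
  have S: "real (S_merge (\<lambda>i. 0) H (mean_window n m \<eta> p \<mu>) t) \<le> 84 * (real (depth t) + 1) * ?Y t"
    using words mono by (rule S_merge_le)
  have Y0: "0 \<le> ?Y t" using words[of t] by linarith
  have "2 * ?Y t \<le> 84 * (real (depth t) + 1) * ?Y t"
    using Y0 by (intro mult_right_mono) auto
  then have "real (truncated_space H (mean_window n m \<eta> p \<mu>) t) \<le> 84 * (real (depth t) + 1) * ?Y t"
    using S words[of t] unfolding truncated_space_def by (auto simp: of_nat_max max_def)
  also have "?Y t \<le> (8 * real n + 2 * \<eta>\<^sub>0) * L * (sqrt B / \<eta>)"
  proof -
    have "\<eta> \<le> \<eta>\<^sub>0 * sqrt B"
      using mult_mono[of \<eta> \<eta>\<^sub>0 1 "sqrt B"] facts \<eta>\<^sub>0 by simp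
    then have "1 \<le> \<eta>\<^sub>0 * (sqrt B / \<eta>)" using facts(1) by simp
    then have "1 * 1 \<le> L * (\<eta>\<^sub>0 * (sqrt B / \<eta>))"
      using facts by (intro mult_mono) auto
    moreover have "?\<alpha> * sqrt B \<le> 8 * real n * L / \<eta> * sqrt B"
      using facts by (intro mult_right_mono divide_right_mono mult_left_mono) auto
    moreover have "(8 * real n + 2 * \<eta>\<^sub>0) * L * (sqrt B / \<eta>)
        = 8 * real n * L / \<eta> * sqrt B + 2 * (L * (\<eta>\<^sub>0 * (sqrt B / \<eta>)))"
      by (simp add: algebra_simps add_divide_distrib)
    ultimately show ?thesis unfolding facts by linarith
  qed
  then have "84 * (real (depth t) + 1) * ?Y t \<le> 84 * (4 * L) * ((8 * real n + 2 * \<eta>\<^sub>0) * L * (sqrt B / \<eta>))"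
    using facts Y0 by (intro mult_mono) auto
  also have "\<dots> = (336 * (8 * real n + 2 * \<eta>\<^sub>0)) * ((sqrt B / \<eta>) * L ^ 2)"
    by (simp add: power2_eq_square)
  also have "\<dots> \<le> cost_const \<eta>\<^sub>0 n * ((sqrt B / \<eta>) * L ^ 3)"
    using facts \<eta>\<^sub>0 cost_const_ge[of \<eta>\<^sub>0 n]
    by (intro mult_mono power_increasing mult_nonneg_nonneg) auto
  finally show ?thesis by (simp add: polylog_def L_def B_def mult_ac)
qed

lemma truncated_time_le:
  "real (truncated_time H (mean_window n m \<eta> p \<mu>) t)
    \<le> cost_const \<eta>\<^sub>0 n * ((sqrt (m * real (block_size p {..<m})) + m) / \<eta>) * polylog 3 (block_size p {..<m} + 1 / \<eta>)"
proof -
  let ?L = "ln (2 + (m + 1 / \<eta>))"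
  let ?\<alpha> = "8 * real n * ?L / \<eta>"
  let ?b = "\<lambda>s. \<Sum>i\<leftarrow>coords s. real (card (alphabet p i))"
  let ?n = "\<lambda>s. real (length (coords s))"
  let ?Y = "\<lambda>s. ?\<alpha> * sqrt (?n s * ?b s) + 2 * ?n s"
  have \<alpha>: "0 \<le> ?\<alpha>" using facts by simp
  have n: "1 \<le> ?n s" for s using coords_nonempty[of s] by (cases "coords s") auto
  have b: "0 \<le> ?b s" for s by (rule sum_list_nonneg_real)
  have superadd: "?Y l + ?Y r \<le> ?Y (Join l r)" for l r
  proof -
    have "?\<alpha> * (sqrt (?n l * ?b l) + sqrt (?n r * ?b r)) \<le> ?\<alpha> * sqrt ((?n l + ?n r) * (?b l + ?b r))"
      using \<alpha> b by (intro mult_left_mono sqrt_mult_superadd) auto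
    then show ?thesis by (simp add: distrib_left)
  qed
  have len: "real (len (merge H (mean_window n m \<eta> p \<mu>) s)) + 1 \<le> ?Y s" for s
  proof -
    have "real (words (merge H (mean_window n m \<eta> p \<mu>) s)) \<le> ?\<alpha> * sqrt (?b s) + 2"
      by (rule words_crop_le[OF facts(1)])
    then have "real (len (merge H (mean_window n m \<eta> p \<mu>) s)) + 1 \<le> ?\<alpha> * sqrt (?b s) + 2"
      by simp
    also have "\<dots> \<le> ?Y s"
      using n[of s] b[of s] \<alpha> mult_right_mono[of 1 "?n s" "?b s"]
      by (intro add_mono mult_left_mono) auto
    finally show ?thesis .
  qed
  let ?T = "(real (depth t) + 1) * (2 + log 2 (?Y t)) * ?Y t"
  have Y1: "1 \<le> ?Y t" using len[of t] by linarith
  have "real (T_merge H (mean_window n m \<eta> p \<mu>) t) \<le> 20 * (real (depth t) + 1) * (2 + log 2 (?Y t)) * ?Y t"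
    using len superadd by (rule T_merge_le)
  then have "real (T_merge H (mean_window n m \<eta> p \<mu>) t) \<le> 20 * ?T"
    by (simp only: mult.assoc)
  moreover have "real (len (merge H (mean_window n m \<eta> p \<mu>) t)) \<le> ?T"
  proof -
    have "1 * 1 * ?Y t \<le> ?T"
      using Y1 by (intro mult_mono) auto
    then show ?thesis using len[of t] by (simp only: mult_1)
  qed
  ultimately have "real (truncated_time H (mean_window n m \<eta> p \<mu>) t) \<le> 20 * ?T + ?T"
    unfolding truncated_time_def of_nat_add by (rule add_mono)
  then have T: "real (truncated_time H (mean_window n m \<eta> p \<mu>) t) \<le> 21 * ?T"
    by (rule order_trans) simp
  have nt: "?n t = real m"
    using t unfolding balanced_tree_def by (metis card_lessThan distinct_card)
  have sqrtB: "sqrt (real m * B) \<le> B"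
    using facts mult_right_mono[of "real m" B B] by (intro real_le_lsqrt) (auto simp: power2_eq_square)
  have Y: "?Y t = ?\<alpha> * sqrt (real m * B) + 2 * real m" unfolding nt facts ..
  have Yle: "?Y t \<le> 8 * real n * L / \<eta> * sqrt (real m * B) + 2 * real m"
    unfolding Y using facts by (intro add_right_mono mult_right_mono divide_right_mono mult_left_mono) auto
  have Y2: "?Y t \<le> (8 * real n + 2 * \<eta>\<^sub>0) * L * ((sqrt (m * B) + m) / \<eta>)"
  proof -
    have "real m \<le> \<eta>\<^sub>0 * (real m / \<eta>)"
      using \<eta>\<^sub>0 facts mult_right_mono[OF \<eta>\<^sub>0, of "real m"] by (simp add: field_simps)
    also have "1 * (\<eta>\<^sub>0 * (real m / \<eta>)) \<le> L * (\<eta>\<^sub>0 * ((sqrt (m * B) + m) / \<eta>))"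
      using facts \<eta>\<^sub>0 by (intro mult_mono divide_right_mono) auto
    finally have 1: "real m \<le> L * (\<eta>\<^sub>0 * ((sqrt (m * B) + m) / \<eta>))" by simp
    have 2: "8 * real n * L / \<eta> * sqrt (m * B) \<le> 8 * real n * L / \<eta> * (sqrt (m * B) + m)"
      using facts by (intro mult_left_mono) auto
    have "(8 * real n + 2 * \<eta>\<^sub>0) * L * ((sqrt (m * B) + m) / \<eta>)
        = 8 * real n * L / \<eta> * (sqrt (m * B) + m) + 2 * (L * (\<eta>\<^sub>0 * ((sqrt (m * B) + m) / \<eta>)))"
      by (simp add: algebra_simps add_divide_distrib)
    then show ?thesis using 1 2 Yle by linarith
  qed
  have "log 2 (?Y t) \<le> (log 2 (8 * real n + 2) + 6) * L"
  proof -
    define z where "z = 2 + (B + 1 / \<eta>)"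
    have z: "1 \<le> z" "B \<le> z" "1 / \<eta> \<le> z"
      using facts by (auto simp: z_def)
    moreover have "L \<le> z"
      unfolding L_def z_def[symmetric] using z by (intro ln_bound) simp
    ultimately have z: "1 \<le> z" "B \<le> z" "1 / \<eta> \<le> z" "L \<le> z" by auto
    have "8 * real n * L / \<eta> * sqrt (m * B) \<le> 8 * real n * (z * z * z)"
    proof -
      have "L * (1 / \<eta>) * sqrt (m * B) \<le> z * z * z"
        using z facts sqrtB by (intro mult_mono) auto
      then have "8 * real n * (L * (1 / \<eta>) * sqrt (m * B)) \<le> 8 * real n * (z * z * z)"
        by (intro mult_left_mono) auto
      then show ?thesis by simp
    qed
    moreover have "2 * real m \<le> 2 * (z * z * z)"
    proof -
      have "real m \<le> 1 * 1 * z" using facts z by simp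
      also have "\<dots> \<le> z * z * z" using z by (intro mult_mono) auto
      finally show ?thesis by simp
    qed
    ultimately have "?Y t \<le> (8 * real n + 2) * z ^ 3"
      using Yle by (simp add: power3_eq_cube algebra_simps)
    then have "log 2 (?Y t) \<le> log 2 ((8 * real n + 2) * z ^ 3)"
      using Y1 by (subst log_le_cancel_iff) auto
    also have "\<dots> = log 2 (8 * real n + 2) + 3 * log 2 z"
      using z by (simp add: log_mult log_nat_power)
    also have "\<dots> \<le> log 2 (8 * real n + 2) * L + 3 * (2 * L)"
    proof (intro add_mono mult_left_mono)
      show "log 2 z \<le> 2 * L" unfolding L_def z_def[symmetric] using z by (intro log2_le) auto
      have "log 2 (8 * real n + 2) * 1 \<le> log 2 (8 * real n + 2) * L"
        using facts by (intro mult_left_mono) auto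
      then show "log 2 (8 * real n + 2) \<le> log 2 (8 * real n + 2) * L" by simp
    qed simp
    also have "\<dots> = (log 2 (8 * real n + 2) + 6) * L"
      by (simp only: distrib_right)
    finally show ?thesis .
  qed
  then have Q: "2 + log 2 (?Y t) \<le> (8 + log 2 (8 * real n + 2)) * L"
    using facts by (simp add: algebra_simps)
  have "21 * ?T \<le> 21 * ((4 * L) * ((8 + log 2 (8 * real n + 2)) * L)
      * ((8 * real n + 2 * \<eta>\<^sub>0) * L * ((sqrt (m * B) + m) / \<eta>)))"
    using Q Y2 Y1 facts by (intro mult_left_mono mult_mono mult_nonneg_nonneg) auto
  also have "\<dots> = cost_const \<eta>\<^sub>0 n * ((sqrt (m * B) + m) / \<eta>) * L ^ 3"
    by (simp add: cost_const_def power3_eq_cube mult_ac)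
  finally show ?thesis using T by (simp add: polylog_def L_def B_def)
qed

end

lemma truncated_time_bounded_le:
  assumes set: "setting m \<eta> p st" and \<eta>\<^sub>0: "\<eta> \<le> \<eta>\<^sub>0" and t: "balanced_tree m t"
    and b: "\<forall>i<m. card (alphabet p i) \<le> b"
  shows "real (truncated_time H (mean_window n m \<eta> p \<mu>) t)
    \<le> cost_const \<eta>\<^sub>0 n * (1 + real b) ^ 4 * (m / \<eta>) * polylog 3 (m + 1 / \<eta>)"
proof -
  let ?B = "real (block_size p {..<m})"
  let ?L = "ln (2 + (m + 1 / \<eta>))"
  have \<eta>: "\<eta> > 0" and m: "m \<ge> 1" using set by (simp_all add: setting_def)
  have mB: "real m \<le> ?B" using card_le_block_size[OF set order_refl] by simp
  have "block_size p {..<m} \<le> (\<Sum>i<m. b)"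
    unfolding block_size_def using b by (intro sum_mono) auto
  then have "?B \<le> real (\<Sum>i<m. b)" by (rule of_nat_mono)
  then have Bb: "?B \<le> b * real m" by (simp add: mult.commute)
  then have b1: "1 \<le> real b"
    using mB m by (cases "b = 0") auto
  have L: "1 \<le> ?L" using m \<eta> by (intro ln_2_plus_ge_1) (simp add: add_increasing2)
  have "2 + (?B + 1 / \<eta>) \<le> real b * (2 + (m + 1 / \<eta>))"
    using Bb b1 \<eta> mult_right_mono[OF b1, of "1 / \<eta>"] by (simp add: algebra_simps)
  then have "ln (2 + (?B + 1 / \<eta>)) \<le> ln (real b * (2 + (m + 1 / \<eta>)))"
    using \<eta> b1 by (subst ln_le_cancel_iff) (auto intro!: mult_pos_pos add_pos_nonneg)
  also have "\<dots> = ln (real b) + ?L"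
    using \<eta> b1 by (intro ln_mult_pos) (auto intro: add_pos_nonneg)
  also have "\<dots> \<le> real b * ?L + ?L"
  proof -
    have "ln (real b) \<le> real b * 1" using ln_bound[of "real b"] b1 by simp
    also have "\<dots> \<le> real b * ?L" using L by (intro mult_left_mono) auto
    finally show ?thesis by simp
  qed
  finally have LB: "ln (2 + (?B + 1 / \<eta>)) \<le> (1 + real b) * ?L" by (simp add: algebra_simps)
  have LB0: "0 \<le> ln (2 + (?B + 1 / \<eta>))" using \<eta> by simp
  have "sqrt (m * ?B) \<le> real b * m"
  proof (rule real_le_lsqrt)
    have "real m * ?B \<le> m * (b * real m)" using Bb by (intro mult_left_mono) auto
    also have "\<dots> \<le> (real b * real b) * (real m * real m)"
      using b1 mult_right_mono[of 1 "real b" "real b * (real m * real m)"] by (simp add: mult_ac)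
    finally show "real m * ?B \<le> (real b * real m)\<^sup>2" by (simp add: power2_eq_square mult_ac)
  qed auto
  then have s: "(sqrt (m * ?B) + m) / \<eta> \<le> (1 + real b) * (m / \<eta>)"
    using \<eta> by (simp add: divide_simps algebra_simps)
  have "real (truncated_time H (mean_window n m \<eta> p \<mu>) t)
    \<le> cost_const \<eta>\<^sub>0 n * ((sqrt (m * ?B) + m) / \<eta>) * ln (2 + (?B + 1 / \<eta>)) ^ 3"
    using truncated_time_le[OF set \<eta>\<^sub>0 t] by (simp add: polylog_def)
  also have "\<dots> \<le> cost_const \<eta>\<^sub>0 n * ((1 + real b) * (m / \<eta>)) * ((1 + real b) * ?L) ^ 3"
    using s LB LB0 \<eta> \<eta>\<^sub>0 cost_const_ge(3)[of \<eta>\<^sub>0 n]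
    by (intro mult_mono mult_nonneg_nonneg power_mono) auto
  finally show ?thesis
    by (simp add: polylog_def power_mult_distrib eval_nat_numeral mult_ac)
qed

lemma window_card_bound:
  assumes set: "setting m \<eta> p st" and \<eta>\<^sub>0: "\<eta> \<le> \<eta>\<^sub>0" and I: "I \<subseteq> {..<m}" "I \<noteq> {}"
  shows "real (card {j::int. \<bar>of_int j * \<eta> - c\<bar> \<le> half_width (4 * real n) 1 m \<eta> p I})
    \<le> cost_const \<eta>\<^sub>0 n * (sqrt (block_size p I) / \<eta>) * polylog 3 (m + 1 / \<eta>)"
proof -
  let ?h = "half_width (4 * real n) 1 m \<eta> p I"
  define L where "L = ln (2 + (m + 1 / \<eta>))"
  define s where "s = sqrt (block_size p I)"
  have \<eta>: "\<eta> > 0" and m: "m \<ge> 1" using set by (simp_all add: setting_def)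
  have L: "1 \<le> L" unfolding L_def using m \<eta> by (intro ln_2_plus_ge_1) (simp add: add_increasing2)
  have s: "1 \<le> s" using block_size_ge_1[OF set I] by (simp add: s_def)
  have h: "?h = 4 * real n * s * L" unfolding half_width_eq s_def L_def by simp
  have "real (card {j::int. \<bar>of_int j * \<eta> - c\<bar> \<le> ?h}) \<le> 2 * ?h / \<eta> + 1"
    using \<eta> L s unfolding h by (intro card_window_le) auto
  also have "\<dots> \<le> 8 * real n * (s / \<eta> * L) + \<eta>\<^sub>0 * (s / \<eta> * L)"
  proof (rule add_mono)
    have "\<eta> * 1 * 1 \<le> \<eta>\<^sub>0 * s * L" using \<eta> \<eta>\<^sub>0 s L by (intro mult_mono) auto
    then show "1 \<le> \<eta>\<^sub>0 * (s / \<eta> * L)" using \<eta> by (simp add: field_simps)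
    show "2 * ?h / \<eta> \<le> 8 * real n * (s / \<eta> * L)" unfolding h by simp
  qed
  also have "\<dots> = (8 * real n + \<eta>\<^sub>0) * (s / \<eta> * L ^ 1)" by (simp add: algebra_simps)
  also have "\<dots> \<le> cost_const \<eta>\<^sub>0 n * (s / \<eta> * L ^ 3)"
    using cost_const_ge[of \<eta>\<^sub>0 n] \<eta> \<eta>\<^sub>0 L s
    by (intro mult_mono power_increasing mult_nonneg_nonneg) auto
  finally show ?thesis by (simp add: s_def L_def polylog_def)
qed

lemma truncated_merge_correct:
  fixes n :: nat
  assumes set: "setting m \<eta> p st" "\<eta> \<le> \<eta>\<^sub>0" "half_decaying m \<eta> ch \<phi> p st"
    and Q: "0 < Q" "2 * exp (4 * exp \<eta>\<^sub>0) * exp (- (n * ln (2 + (m + 1 / \<eta>)))) \<le> 1 / (2 * m * Q)"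
  defines "\<mu> \<equiv> chain_law ch \<phi> p st"
  shows "I \<subseteq> {..<m} \<Longrightarrow> I \<noteq> {} \<Longrightarrow> measure_pmf.prob (block_law \<mu> I)
      {w. \<bar>w - block_mean \<mu> I\<bar> \<le> half_width (4 * real n) 1 m \<eta> p I} \<ge> 1 - 1 / Q"
    and "balanced_tree m t \<Longrightarrow> l1_dist (merge (\<lambda>i. histogram \<eta> (\<mu> i)) (mean_window n m \<eta> p \<mu>) t)
      (merge (\<lambda>i. histogram \<eta> (\<mu> i)) no_crop t) \<le> 1 / Q"
proof -
  have \<eta>: "\<eta> > 0" and m: "m \<ge> 1" using set by (simp_all add: setting_def)
  let ?h = "half_width (4 * real n) 1 m \<eta> p"
  define \<delta> where "\<delta> = 1 / (2 * m * Q)"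
  have \<delta>: "0 \<le> \<delta>" "2 * real m * \<delta> = 1 / Q" using Q m by (auto simp: \<delta>_def)
  have "1 * \<delta> \<le> 2 * real m * \<delta>" using \<delta>(1) m by (intro mult_right_mono) auto
  then have \<delta>Q: "\<delta> \<le> 1 / Q" using \<delta>(2) by simp
  have tail: "measure_pmf.prob (block_law \<mu> I) {w. \<not> \<bar>w - block_mean \<mu> I\<bar> \<le> ?h I} \<le> \<delta>"
    if I: "I \<subseteq> {..<m}" "I \<noteq> {}" for I
  proof -
    have "0 < sqrt (real (block_size p I))"
      using block_size_ge_1[OF set(1) I] by simp
    then have "?h I / (4 * sqrt (block_size p I)) = n * ln (2 + (m + 1 / \<eta>))"
      unfolding half_width_eq by simp
    then show ?thesis
      using half_decaying_tail[OF set I, of "?h I"] Q(2) unfolding \<mu>_def \<delta>_def by simp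
  qed
  show "measure_pmf.prob (block_law \<mu> I) {w. \<bar>w - block_mean \<mu> I\<bar> \<le> ?h I} \<ge> 1 - 1 / Q"
    if "I \<subseteq> {..<m}" "I \<noteq> {}"
  proof -
    have "measure_pmf.prob (block_law \<mu> I) {w. \<not> \<bar>w - block_mean \<mu> I\<bar> \<le> ?h I}
      = 1 - measure_pmf.prob (block_law \<mu> I) {w. \<bar>w - block_mean \<mu> I\<bar> \<le> ?h I}"
      using measure_pmf.prob_compl[of "{w. \<bar>w - block_mean \<mu> I\<bar> \<le> ?h I}" "block_law \<mu> I"]
      by (simp add: Compl_eq_Diff_UNIV[symmetric] Collect_neg_eq)
    then show ?thesis using tail[OF that] \<delta>Q by linarith
  qed
  show "l1_dist (merge (\<lambda>i. histogram \<eta> (\<mu> i)) (mean_window n m \<eta> p \<mu>) t)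
      (merge (\<lambda>i. histogram \<eta> (\<mu> i)) no_crop t) \<le> 1 / Q"
    if t: "balanced_tree m t"
  proof -
    let ?A = "merge (\<lambda>i. histogram \<eta> (\<mu> i)) (mean_window n m \<eta> p \<mu>) t"
    have c: "distinct (coords t)" "set (coords t) = {..<m}"
      using t by (simp_all add: balanced_tree_def)
    have grid: "grid_supported \<eta> (\<mu> i)" if "i \<in> {..<m}" for i
      using grid_supported_chain_law[OF set(1)] that by (simp add: \<mu>_def)
    have len: "length (coords t) = m" using c by (metis card_lessThan distinct_card)
    have A: "dominated \<eta> (block_law \<mu> (set (coords t))) ?A"
      "1 - (2 * real (length (coords t)) - 1) * \<delta> \<le> gmass ?A"
      using merge_truncated[OF \<eta> c(1), of "{..<m}" \<mu> "block_mean \<mu>" ?h \<delta>] grid tail c by auto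
    have "l1_dist ?A (merge (\<lambda>i. histogram \<eta> (\<mu> i)) no_crop t) = 1 - gmass ?A"
    proof (rule l1_dist_dominated[OF \<eta> _ A(1)])
      show "grid_supported \<eta> (block_law \<mu> (set (coords t)))"
        using grid c by (intro grid_supported_block_law) auto
      show "entry (merge (\<lambda>i. histogram \<eta> (\<mu> i)) no_crop t) j
          = pmf (block_law \<mu> (set (coords t))) (of_int j * \<eta>)" for j
        by (rule entry_merge_full[OF \<eta> c(1)]) (use grid c in auto)
    qed
    also have "\<dots> \<le> 2 * real m * \<delta>"
      using A(2) \<delta>(1) unfolding len by (simp add: algebra_simps)
    finally show ?thesis using \<delta>(2) by simp
  qed
qed

theorem lemma4p3:
  shows
    "(\<exists>C k c. c > 0 \<and>
      (\<forall>m \<eta> (p :: nat \<Rightarrow> 'a pmf) st ch \<phi> t.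
        setting m \<eta> p st \<and> balanced_tree m t \<longrightarrow>
        (let \<mu> = chain_law ch \<phi> p st;
             H = (\<lambda>i. histogram \<eta> (\<mu> i));
             R = surprisal_range p m;
             B = real (block_size p {..<m})
         in (\<forall>j. entry (merge H no_crop t) j = pmf (block_law \<mu> {..<m}) (of_int j * \<eta>)) \<and>
            real (full_time (\<lambda>i. card (alphabet p i)) H t)
              \<le> C * (R / \<eta> + B) * polylog k (R / \<eta> + B) \<and>
            c * (R / \<eta> + m) \<le> real (full_space H t) \<and>
            real (full_space H t) \<le> C * (R / \<eta> + m)))) \<and>
    (\<forall>\<eta>\<^sub>0 > 0. \<forall>P :: real poly poly.
      (\<forall>m::nat. \<forall>\<eta>. m \<ge> 1 \<and> 0 < \<eta> \<and> \<eta> \<le> \<eta>\<^sub>0 \<longrightarrow> poly2 P m (1 / \<eta>) > 0) \<longrightarrow>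
      (\<exists>C\<^sub>w k\<^sub>w.
        (\<exists>C k. \<forall>m \<eta> (p :: nat \<Rightarrow> 'a pmf) st ch \<phi>.
          setting m \<eta> p st \<and> \<eta> \<le> \<eta>\<^sub>0 \<and> half_decaying m \<eta> ch \<phi> p st \<longrightarrow>
          (let \<mu> = chain_law ch \<phi> p st;
               H = (\<lambda>i. histogram \<eta> (\<mu> i));
               h = half_width C\<^sub>w k\<^sub>w m \<eta> p;
               crop = (\<lambda>I. window \<eta> (block_mean \<mu> I) (h I));
               B = real (block_size p {..<m})
           in (\<forall>I. I \<subseteq> {..<m} \<and> I \<noteq> {} \<longrightarrow>
                 measure_pmf.prob (block_law \<mu> I) {w. \<bar>w - block_mean \<mu> I\<bar> \<le> h I}
                   \<ge> 1 - 1 / poly2 P m (1 / \<eta>) \<and>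
                 real (card {j::int. \<bar>of_int j * \<eta> - block_mean \<mu> I\<bar> \<le> h I})
                   \<le> C * (sqrt (block_size p I) / \<eta>) * polylog k (m + 1 / \<eta>)) \<and>
              (\<forall>t. balanced_tree m t \<longrightarrow>
                 l1_dist (merge H crop t) (merge H no_crop t) \<le> 1 / poly2 P m (1 / \<eta>) \<and>
                 real (truncated_time H crop t)
                   \<le> C * ((sqrt (m * B) + m) / \<eta>) * polylog k (B + 1 / \<eta>) \<and>
                 real (truncated_space H crop t)
                   \<le> C * (sqrt B / \<eta>) * polylog k (B + 1 / \<eta>)))) \<and>
        (\<forall>b::nat. \<exists>C k. \<forall>m \<eta> (p :: nat \<Rightarrow> 'a pmf) st ch \<phi> t.
          setting m \<eta> p st \<and> \<eta> \<le> \<eta>\<^sub>0 \<and> half_decaying m \<eta> ch \<phi> p st \<and>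
          (\<forall>i<m. card (alphabet p i) \<le> b) \<and> balanced_tree m t \<longrightarrow>
          (let \<mu> = chain_law ch \<phi> p st;
               H = (\<lambda>i. histogram \<eta> (\<mu> i));
               crop = (\<lambda>I. window \<eta> (block_mean \<mu> I) (half_width C\<^sub>w k\<^sub>w m \<eta> p I))
           in real (truncated_time H crop t) \<le> C * (m / \<eta>) * polylog k (m + 1 / \<eta>)))))"
proof (intro conjI allI impI, goal_cases)
  case 1
  show ?case
  proof (rule exI[of _ 2200], rule exI[of _ 2], rule exI[of _ 1], intro conjI allI impI, goal_cases)
    case (2 m \<eta> p st ch \<phi> t)
    then have set: "setting m \<eta> p st" and t: "balanced_tree m t" by auto
    have \<eta>: "\<eta> > 0" using set by (simp add: setting_def)
    have "0 \<le> surprisal_range p m / \<eta> + real m"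
      using surprisal_range_nonneg[OF set] \<eta> by simp
    then have "129 * (surprisal_range p m / \<eta> + m) \<le> 2200 * (surprisal_range p m / \<eta> + m)"
      by (intro mult_right_mono) auto
    moreover have "entry (merge (\<lambda>i. histogram \<eta> (chain_law ch \<phi> p st i)) no_crop t) j
        = pmf (block_law (chain_law ch \<phi> p st) {..<m}) (of_int j * \<eta>)" for j
      using entry_merge_full[OF \<eta>, of t "chain_law ch \<phi> p st" j] t grid_supported_chain_law[OF set]
      by (simp add: balanced_tree_def)
    ultimately show ?case
      unfolding Let_def mult_1
      by (intro conjI allI full_time_le[OF set t] full_space_bounds(1)[OF set t]
          order_trans[OF full_space_bounds(2)[OF set t]])
  qed simp
next
  case (2 \<eta>\<^sub>0 P)
  note \<eta>\<^sub>0 = 2(1) and pos = 2(2)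
  have pos': "poly2 P m (1 / \<eta>) > 0" if "m \<ge> 1" "0 < \<eta>" "\<eta> \<le> \<eta>\<^sub>0" for m :: nat and \<eta>
    using pos that by simp
  obtain n :: nat where n: "\<And>(m::nat) \<eta>. m \<ge> 1 \<Longrightarrow> 0 < \<eta> \<Longrightarrow> \<eta> \<le> \<eta>\<^sub>0 \<Longrightarrow>
    2 * exp (4 * exp \<eta>\<^sub>0) * exp (- (n * ln (2 + (m + 1 / \<eta>)))) \<le> 1 / (2 * m * poly2 P m (1 / \<eta>))"
    using tail_exponent[OF \<eta>\<^sub>0 pos'] by blast
  have Q: "0 < poly2 P m (1 / \<eta>)"
    "2 * exp (4 * exp \<eta>\<^sub>0) * exp (- (n * ln (2 + (m + 1 / \<eta>)))) \<le> 1 / (2 * m * poly2 P m (1 / \<eta>))"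
    if "setting m \<eta> p st" "\<eta> \<le> \<eta>\<^sub>0" for m \<eta> and p :: "nat \<Rightarrow> 'a pmf" and st
    using n pos' that by (simp_all add: setting_def)
  show ?case
  proof (rule exI[of _ "4 * real n"], rule exI[of _ 1], rule conjI, goal_cases)
    case 1
    show ?case
    proof (rule exI[of _ "cost_const \<eta>\<^sub>0 n"], rule exI[of _ 3], intro allI impI, goal_cases)
      case (1 m \<eta> p st ch \<phi>)
      then have set: "setting m \<eta> p st" "\<eta> \<le> \<eta>\<^sub>0" "half_decaying m \<eta> ch \<phi> p st" by auto
      show ?case
        unfolding Let_def
        by (intro conjI allI impI truncated_merge_correct[OF set Q[OF set(1,2)]]
            window_card_bound[OF set(1,2)] truncated_time_le[OF set(1,2)]
            truncated_space_le[OF set(1,2)]; blast)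
    qed
  next
    case 2
    show ?case
    proof (rule allI, goal_cases)
      case (1 b)
      show ?case
        by (rule exI[of _ "cost_const \<eta>\<^sub>0 n * (1 + real b) ^ 4"], rule exI[of _ 3], unfold Let_def,
            intro allI impI truncated_time_bounded_le; blast)
    qed
  qed
qed

end
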